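(* There exists a universal constant $C>0$ such that for every square $Q\subseteq\mathbb{R}^2$ of side length $1$ (arbitrary centre and orientation) and all $f,g\in L^2(\mathbb{R})$ with $f\neq 0$, $$\min_{\tau\in\mathbb{T}} \|\mathcal{G} g- \tau\, \mathcal{G} f\|_{L^2(Q)} \le C \left(\frac{\|\mathcal{S} f\|_{L^\infty(\mathbb{R}^2)} + \|\mathcal{S} g\|_{L^\infty(\mathbb{R}^2)}}{\|\mathcal{S} f\|_{L^1(Q)}}\right)^{1/2} \|\mathcal{S} f -\mathcal{S} g\|_{L^2(Q)}^{1/2}.$$
   Context: $\mathbb{T}=\{\tau\in\mathbb{C}:|\tau|=1\}$. For $f\in L^2(\mathbb{R})$ the Gabor transform is $\mathcal{G}f(x,y)=\int_{\mathbb{R}} f(t)e^{-\pi(t-x)^2}e^{-2\pi i t y}\,dt$ for $x,y\in\mathbb{R}$, and the spectrogram is $\mathcal{S}f=|\mathcal{G}f|^2$. Norms are taken with respect to Lebesgue measure on $\mathbb{R}^2$. *)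

theory Defs
  imports "HOL-Analysis.Analysis" "HOL-Probability.Essential_Supremum"
begin

text \<open>Elements of \<open>L\<^sup>2(\<real>)\<close> are represented by functions; equality in \<open>L\<^sup>2(\<real>)\<close> is equality
  almost everywhere.\<close>

definition square_integrable :: "(real \<Rightarrow> complex) \<Rightarrow> bool" where
  "square_integrable f \<longleftrightarrow>
     f \<in> borel_measurable lebesgue \<and> integrable lebesgue (\<lambda>t. (cmod (f t))\<^sup>2)"

definition gabor :: "(real \<Rightarrow> complex) \<Rightarrow> real \<times> real \<Rightarrow> complex" where
  "gabor f = (\<lambda>(x, y).
     LINT t|lebesgue. f t * of_real (exp (- pi * (t - x)\<^sup>2)) * exp (- 2 * of_real pi * \<i> * of_real t * of_real y))"

definition spectrogram :: "(real \<Rightarrow> complex) \<Rightarrow> real \<times> real \<Rightarrow> real" where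
  "spectrogram f z = (cmod (gabor f z))\<^sup>2"

text \<open>Both norms below are real-valued, so a function that is not
  measurable or has infinite norm gets the value \<open>0\<close>. They are
  meant for functions of finite norm only, such as a Gabor transform or spectrogram of a square
  integrable function (which is bounded and continuous) on a bounded set, or on the whole plane in
  the case of \<open>Linf_norm\<close>.\<close>

definition Lp_norm :: "real \<Rightarrow> 'a measure \<Rightarrow> ('a \<Rightarrow> 'b::real_normed_vector) \<Rightarrow> real" where
  "Lp_norm p M F = (LINT z|M. norm (F z) powr p) powr (1 / p)"

definition Linf_norm :: "'a measure \<Rightarrow> ('a \<Rightarrow> 'b::real_normed_vector) \<Rightarrow> real" where
  "Linf_norm M F = real_of_ereal (esssup M (\<lambda>z. ereal (norm (F z))))"

text \<open>The closed square with centre \<open>c\<close> and side length \<open>l\<close>, whose sides are parallel to the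
  orthonormal vectors \<open>u\<close> and \<open>v\<close>.\<close>

definition is_square :: "real \<Rightarrow> (real \<times> real) set \<Rightarrow> bool" where
  "is_square l Q \<longleftrightarrow>
     (\<exists>c u v. norm u = 1 \<and> norm v = 1 \<and> u \<bullet> v = 0 \<and>
        Q = {c + s *\<^sub>R u + t *\<^sub>R v | s t. \<bar>s\<bar> \<le> l / 2 \<and> \<bar>t\<bar> \<le> l / 2})"

end

theory Submission
  imports Defs "HOL-Complex_Analysis.Complex_Analysis" "HOL-Probability.Probability"
begin

text \<open>Up to a Gaussian weight and a unimodular factor, both common to all signals, the conjugate of
\<open>gabor f\<close> is an entire function (the Bargmann transform of \<open>f\<close>). After
recentring at the centre of the square, \<open>f\<close> and \<open>g\<close> are therefore replaced by entire
functions \<open>F\<close> and \<open>G\<close>, and the data \<open>|F z|\<^sup>2 - |G z|\<^sup>2\<close> are the restriction to the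
diagonal \<open>w = z\<close> of the sesquiholomorphic function
\<open>D z w = F z * cnj (F w) - G z * cnj (G w)\<close>. In real coordinates \<open>z = x + \<i> y\<close> the diagonal becomes
the real plane inside complex two-space, so that the problem is one of propagation of smallness: an
entire function that is small in mean on a segment and bounded on a large disc is small on
the unit disc (\<open>entire_norm_le_segment_integral\<close>).

An estimate of this type interpolates between the small mean \<open>E\<close> and the bound \<open>K\<close>, and the
exponents depend on the radius of the large disc. Since \<open>F\<close> and \<open>G\<close> are entire and the
spectrograms are bounded on the whole plane, this radius can be chosen as large as desired, at the price of an
absolute constant. Applying the estimate in \<open>x\<close> and in \<open>y\<close> with radius \<open>1536 ^ 4\<close> gives
\<open>|D z w|\<^sup>2 \<le> C * K * E\<close>, which is exactly the square root rate of the theorem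
(\<open>polarized_difference_bound\<close>). The bound \<open>K\<close> is a multiple of the sum of the two
\<open>L\<^sup>\<infinity>\<close> norms, and \<open>E\<close> is at most a multiple of the \<open>L\<^sup>2\<close> distance of the spectrograms on the
square.

Phase retrieval then is a statement about rank one operators. Write \<open>a\<close> and \<open>b\<close> for the squared
\<open>L\<^sup>2(Q)\<close> norms of the two Gabor transforms and \<open>s\<close> for the modulus of their inner product. The kernel
\<open>D\<close> has squared \<open>L\<^sup>2(Q \<times> Q)\<close> norm \<open>a\<^sup>2 + b\<^sup>2 - 2 * s\<^sup>2\<close>, while the best unimodular multiple has squared
distance \<open>a + b - 2 * s\<close>; the second quantity times \<open>a\<close> is at most twice the first
(\<open>phase_distance_from_rank_one_difference\<close>). The factor \<open>a\<close> is the \<open>L\<^sup>1(Q)\<close> norm of the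
spectrogram of \<open>f\<close>. It is positive by the identity theorem and the injectivity of the Bargmann
transform (\<open>gabor_nonzero_near_every_point\<close>); without this the quotient in the theorem would be a
division by zero.\<close>

section \<open>Polynomials with well separated sample points\<close>

lemma prod_abs_diff_atMost:
  assumes "i \<le> n"
  shows "(\<Prod>j\<in>{..n} - {i}. \<bar>real i - real j\<bar>) = fact i * fact (n - i)"
proof -
  have low: "(\<Prod>j<i. \<bar>real i - real j\<bar>) = fact i"
  proof -
    have "(\<Prod>j<i. \<bar>real i - real j\<bar>) = (\<Prod>j<i. real (i - j))"
      by (intro prod.cong) auto
    then show ?thesis by (simp add: fact_prod_rev atLeast0LessThan)
  qed
  have high: "(\<Prod>j\<in>{i<..i + d}. \<bar>real i - real j\<bar>) = fact d" for d
  proof (induction d)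
    case (Suc d)
    have "{i<..i + Suc d} = insert (i + Suc d) {i<..i + d}" by auto
    then show ?case using Suc by (simp add: algebra_simps)
  qed simp
  have "{..n} - {i} = {..<i} \<union> {i<..i + (n - i)}" using assms by auto
  moreover have "(\<Prod>j\<in>{..<i} \<union> {i<..i + (n - i)}. \<bar>real i - real j\<bar>)
      = (\<Prod>j<i. \<bar>real i - real j\<bar>) * (\<Prod>j\<in>{i<..i + (n - i)}. \<bar>real i - real j\<bar>)"
    by (intro prod.union_disjoint) auto
  ultimately show ?thesis by (simp only: low high)
qed

lemma sum_inverse_fact_fact: "(\<Sum>i\<le>n. 1 / (fact i * fact (n - i))) = 2 ^ n / (fact n :: real)"
proof -
  have "(\<Sum>i\<le>n. 1 / (fact i * fact (n - i))) = (\<Sum>i\<le>n. real (n choose i) / fact n)"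
    by (intro sum.cong) (auto simp: binomial_fact field_simps)
  also have "\<dots> = real (\<Sum>i\<le>n. n choose i) / fact n"
    by (simp add: sum_divide_distrib)
  finally show ?thesis by (simp add: choose_row_sum)
qed

text \<open>Lagrange interpolation at the nodes \<open>x i\<close>: their separation bounds the denominators of the basis
polynomials below by \<open>h ^ n * (fact i * fact (n - i))\<close>, and the resulting sum over \<open>i\<close> is
\<open>sum_inverse_fact_fact\<close>. For \<open>h\<close> of order \<open>1 / n\<close> the constant grows only exponentially in \<open>n\<close>,
which is what the trade-off with the Taylor remainder requires.\<close>

lemma poly_norm_le_separated_nodes:
  fixes p :: "complex poly" and x :: "nat \<Rightarrow> real"
  assumes deg: "degree p \<le> n" and h: "h > 0"
    and sep: "\<And>i j. i \<le> n \<Longrightarrow> j \<le> n \<Longrightarrow> \<bar>real i - real j\<bar> * h \<le> \<bar>x i - x j\<bar>"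
    and x1: "\<And>i. i \<le> n \<Longrightarrow> \<bar>x i\<bar> \<le> 1" and z: "norm z \<le> 1"
    and m: "\<And>i. i \<le> n \<Longrightarrow> norm (poly p (of_real (x i))) \<le> m"
  shows "norm (poly p z) \<le> (4 / h) ^ n / fact n * m"
proof -
  define X :: "nat \<Rightarrow> complex" where "X i = of_real (x i)" for i
  define L where "L i = (\<Prod>j\<in>{..n} - {i}. smult (1 / (X i - X j)) [:- X j, 1:])" for i
  have neq: "X i \<noteq> X j" if "i \<le> n" "j \<le> n" "i \<noteq> j" for i j
  proof -
    have "0 < \<bar>real i - real j\<bar> * h" using that h by simp
    then show ?thesis using sep[of i j] that by (auto simp: X_def)
  qed
  have inj: "inj_on X {..n}" using neq by (auto simp: inj_on_def)
  have polyL: "poly (L i) w = (\<Prod>j\<in>{..n} - {i}. (w - X j) / (X i - X j))" for i w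
    by (simp add: L_def poly_prod diff_divide_distrib)
  have degL: "degree (L i) \<le> n" if "i \<le> n" for i
  proof -
    have "degree (L i) \<le> (\<Sum>j\<in>{..n} - {i}. degree (smult (1 / (X i - X j)) [:- X j, 1:]))"
      unfolding L_def by (intro degree_prod_sum_le[THEN order_trans]) (auto simp: o_def)
    also have "\<dots> \<le> (\<Sum>j\<in>{..n} - {i}. 1)" by (intro sum_mono) (auto simp: degree_smult_le)
    also have "\<dots> \<le> n" using that by simp
    finally show ?thesis .
  qed
  have L_node: "poly (L i) (X k) = (if i = k then 1 else 0)" if "i \<le> n" "k \<le> n" for i k
    using that neq by (auto simp: polyL intro!: prod.neutral)
  have "p = (\<Sum>i\<le>n. smult (poly p (X i)) (L i))"
  proof (rule poly_eqI_degree[where A = "X ` {..n}"])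
    fix w assume "w \<in> X ` {..n}"
    then obtain k where k: "k \<le> n" "w = X k" by auto
    have "poly (\<Sum>i\<le>n. smult (poly p (X i)) (L i)) (X k) = (\<Sum>i\<le>n. poly p (X i) * (if i = k then 1 else 0))"
      using k unfolding poly_sum poly_smult by (intro sum.cong) (auto simp: L_node)
    also have "\<dots> = poly p (X k)" using k by (simp add: if_distrib sum.delta cong: if_cong)
    finally show "poly p w = poly (\<Sum>i\<le>n. smult (poly p (X i)) (L i)) w" using k by simp
  next
    have "card (X ` {..n}) = Suc n" using inj by (simp add: card_image)
    then show "card (X ` {..n}) > degree p" using deg by simp
    have "degree (\<Sum>i\<le>n. smult (poly p (X i)) (L i)) \<le> n"
      by (intro degree_sum_le) (auto intro: order_trans[OF degree_smult_le] degL)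
    then show "card (X ` {..n}) > degree (\<Sum>i\<le>n. smult (poly p (X i)) (L i))"
      using \<open>card (X ` {..n}) = Suc n\<close> by simp
  qed
  then have "poly p z = (\<Sum>i\<le>n. poly p (X i) * poly (L i) z)"
    by (metis (no_types, lifting) poly_smult poly_sum sum.cong)
  also have "norm \<dots> \<le> (\<Sum>i\<le>n. m * ((2 / h) ^ n * (1 / (fact i * fact (n - i)))))"
  proof (intro sum_norm_le)
    fix i assume "i \<in> {..n}"
    then have i: "i \<le> n" by simp
    have "norm (poly (L i) z) = (\<Prod>j\<in>{..n} - {i}. norm (z - X j) / norm (X i - X j))"
      by (simp add: polyL prod_norm[symmetric] norm_divide)
    also have "\<dots> \<le> (\<Prod>j\<in>{..n} - {i}. (2 / h) * (1 / \<bar>real i - real j\<bar>))"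
    proof (intro prod_mono conjI)
      fix j assume j: "j \<in> {..n} - {i}"
      have a: "norm (z - X j) \<le> 2"
        using norm_triangle_ineq4[of z "X j"] z x1[of j] j by (simp add: X_def)
      have b: "norm (X i - X j) = \<bar>x i - x j\<bar>" by (simp add: X_def flip: of_real_diff)
      have c: "0 < \<bar>real i - real j\<bar> * h" using j h by auto
      have d: "\<bar>real i - real j\<bar> * h \<le> \<bar>x i - x j\<bar>" using sep i j by simp
      have "norm (z - X j) / norm (X i - X j) \<le> 2 / (\<bar>real i - real j\<bar> * h)"
        unfolding b by (rule frac_le) (use a c d in auto)
      then show "norm (z - X j) / norm (X i - X j) \<le> (2 / h) * (1 / \<bar>real i - real j\<bar>)"
        by (simp add: field_simps)
    qed auto
    also have "\<dots> = (2 / h) ^ n * (1 / (fact i * fact (n - i)))"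
      using i prod_abs_diff_atMost[OF i] by (simp add: prod.distrib prod_dividef power_divide)
    finally have "norm (poly (L i) z) \<le> (2 / h) ^ n * (1 / (fact i * fact (n - i)))" .
    moreover have "norm (poly p (X i)) \<le> m" using m[OF i] by (simp add: X_def)
    ultimately show "norm (poly p (X i) * poly (L i) z) \<le> m * ((2 / h) ^ n * (1 / (fact i * fact (n - i))))"
      unfolding norm_mult by (intro mult_mono) (auto intro: order_trans[OF norm_ge_zero])
  qed
  also have "\<dots> = m * (2 / h) ^ n * (\<Sum>i\<le>n. 1 / (fact i * fact (n - i)))"
    by (simp add: sum_distrib_left mult.assoc)
  also have "\<dots> = (4 / h) ^ n / fact n * m"
  proof -
    have "(2 / h) ^ n * 2 ^ n = ((2 / h) * 2) ^ n" by (rule power_mult_distrib[symmetric])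
    then have "(2 / h) ^ n * 2 ^ n = (4 / h) ^ n" by simp
    then show ?thesis unfolding sum_inverse_fact_fact by (simp add: mult.assoc mult.commute)
  qed
  finally show ?thesis .
qed

section \<open>Propagation of smallness from a segment\<close>

lemma exists_point_le_integral:
  fixes u :: "real \<Rightarrow> complex"
  assumes cont: "continuous_on {0..c} u" and ab: "0 \<le> a" "a \<le> b" "b \<le> c"
  shows "\<exists>x\<in>{a..b}. (b - a) * norm (u x) \<le> integral {0..c} (\<lambda>t. norm (u t))"
proof -
  have cn: "continuous_on {0..c} (\<lambda>t. norm (u t))" by (intro continuous_intros cont)
  have ca: "continuous_on {a..b} (\<lambda>t. norm (u t))"
    by (rule continuous_on_subset[OF cn]) (use ab in auto)
  then obtain x where x: "x \<in> {a..b}" "\<And>y. y \<in> {a..b} \<Longrightarrow> norm (u x) \<le> norm (u y)"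
    using continuous_attains_inf[of "{a..b}" "\<lambda>t. norm (u t)"] ab by auto
  have "(b - a) * norm (u x) = integral {a..b} (\<lambda>_. norm (u x))" using ab by simp
  also have "\<dots> \<le> integral {a..b} (\<lambda>t. norm (u t))"
    using x by (intro integral_le) (auto intro: integrable_continuous_real ca)
  also have "\<dots> \<le> integral {0..c} (\<lambda>t. norm (u t))"
    using ab by (intro integral_subset_le integrable_continuous_real ca cn) auto
  finally show ?thesis using x(1) by blast
qed

lemma entire_taylor_remainder:
  assumes hol: "u holomorphic_on UNIV" and R: "R \<ge> 2"
    and K: "\<And>z. norm z \<le> R \<Longrightarrow> norm (u z) \<le> K"
  obtains p :: "complex poly" where "degree p \<le> n" "\<And>z. norm z \<le> 1 \<Longrightarrow> norm (u z - poly p z) \<le> K / R ^ n"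
proof -
  define b where "b k = (deriv ^^ k) u 0 / fact k" for k
  define p where "p = (\<Sum>k\<le>n. monom (b k) k)"
  have K0: "K \<ge> 0" using K[of 0] R norm_ge_zero[of "u 0"] by (simp del: norm_ge_zero)
  have b: "norm (b k) \<le> K / R ^ k" for k
  proof -
    have "norm ((deriv ^^ k) u 0) \<le> fact k * K / R ^ k"
      using R by (intro Cauchy_inequality holomorphic_on_subset[OF hol]
          holomorphic_on_imp_continuous_on K) auto
    then show ?thesis by (simp add: b_def norm_divide field_simps)
  qed
  have "degree p \<le> n"
    unfolding p_def by (intro degree_sum_le) (auto intro: order_trans[OF degree_monom_le])
  moreover have "norm (u z - poly p z) \<le> K / R ^ n" if z: "norm z \<le> 1" for z
  proof -
    have "(\<lambda>k. b k * z ^ k) sums u z"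
      using holomorphic_power_series[of u 0 2 z] holomorphic_on_subset[OF hol] z by (simp add: b_def)
    then have s: "(\<lambda>k. b (k + Suc n) * z ^ (k + Suc n)) sums (u z - (\<Sum>k<Suc n. b k * z ^ k))"
      by (rule sums_split_initial_segment)
    have t: "(\<lambda>k. K / R ^ n * (1 / 2) ^ Suc k) sums (K / R ^ n * 1)"
      by (intro sums_mult power_half_series)
    have pz: "poly p z = (\<Sum>k<Suc n. b k * z ^ k)"
      by (simp add: p_def poly_sum poly_monom lessThan_Suc_atMost)
    have bd: "norm (b (k + Suc n) * z ^ (k + Suc n)) \<le> K / R ^ n * (1 / 2) ^ Suc k" for k
    proof -
      have "norm (b (k + Suc n) * z ^ (k + Suc n)) \<le> K / R ^ (k + Suc n) * 1"
        unfolding norm_mult norm_power using z K0 R by (intro mult_mono power_le_one b) auto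
      also have "\<dots> = K / R ^ n * (1 / R) ^ Suc k"
        by (simp add: power_add power_divide field_simps)
      also have "\<dots> \<le> K / R ^ n * (1 / 2) ^ Suc k"
        using K0 R by (intro mult_left_mono power_mono) (auto simp: field_simps)
      finally show ?thesis .
    qed
    have "norm (\<Sum>k. b (k + Suc n) * z ^ (k + Suc n)) \<le> (\<Sum>k. K / R ^ n * (1 / 2) ^ Suc k)"
      using bd t by (intro norm_suminf_le) (auto simp: sums_iff)
    then show ?thesis using s t pz by (simp add: sums_iff)
  qed
  ultimately show ?thesis using that by blast
qed

text \<open>The left side over \<open>fact n\<close> is a single term of the exponential series at \<open>Suc n\<close>.\<close>

lemma power_Suc_le_fact_exp: "real (Suc n) ^ n \<le> fact n * 3 ^ Suc n"
proof -
  have "exp (real (Suc n)) = (\<Sum>k. real (Suc n) ^ k / fact k)"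
    unfolding exp_def by (intro suminf_cong) (simp add: divide_inverse_commute)
  moreover have "summable (\<lambda>k. real (Suc n) ^ k / fact k)"
    using summable_exp[of "real (Suc n)"] by (simp only: divide_inverse_commute)
  ultimately have "real (Suc n) ^ n / fact n \<le> exp (real (Suc n))"
    using sum_le_suminf[of "\<lambda>k. real (Suc n) ^ k / fact k" "{n}"] by simp
  also have "\<dots> = exp 1 ^ Suc n" using exp_of_nat_mult[of "Suc n" "1::real"] by simp
  also have "\<dots> \<le> 3 ^ Suc n" by (intro power_mono exp_le) auto
  finally show ?thesis by (simp only: pos_divide_le_eq fact_gt_zero mult.commute)
qed

text \<open>The function is compared with its Taylor polynomial of degree \<open>n\<close>, whose error is at most
\<open>K / R ^ n\<close>. Among \<open>2 * (n + 1)\<close> equal subintervals of \<open>[0, 1/4]\<close> take every second one; each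
contains a point where the modulus is at most the whole integral divided by the length of the subinterval, and skipping the others keeps
these points separated by at least the length of a subinterval. Interpolation
at these points costs \<open>32 ^ n * 3 ^ (n + 1)\<close> and a factor linear in \<open>n\<close>, which together are absorbed
by \<open>(96 * 16) ^ (n + 1)\<close>. The free parameter \<open>n\<close> is kept, since the
optimal choice depends on the ratio of \<open>K\<close> and the integral.\<close>

lemma entire_norm_le_segment_integral:
  assumes hol: "u holomorphic_on UNIV" and R: "R \<ge> 2"
    and K: "\<And>z. norm z \<le> R \<Longrightarrow> norm (u z) \<le> K" and z: "norm z \<le> 1"
  shows "norm (u z) \<le> 1536 ^ Suc n * (integral {0..1/4} (\<lambda>t. norm (u (of_real t))) + K / R ^ n)"
proof -
  define J where "J = integral {0..1/4} (\<lambda>t. norm (u (of_real t)))"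
  define \<rho> where "\<rho> = K / R ^ n"
  define N where "N = real (Suc n)"
  define h where "h = 1 / (8 * N)"
  have N: "N \<ge> 1" by (simp add: N_def)
  have h0: "h > 0" using N by (simp add: h_def)
  have K0: "K \<ge> 0" using K[of 0] R norm_ge_zero[of "u 0"] by (simp del: norm_ge_zero)
  have rho0: "\<rho> \<ge> 0" using K0 R by (simp add: \<rho>_def)
  obtain p :: "complex poly" where p: "degree p \<le> n"
    "\<And>z. norm z \<le> 1 \<Longrightarrow> norm (u z - poly p z) \<le> \<rho>"
    using entire_taylor_remainder[OF hol R K] unfolding \<rho>_def by metis
  have cont: "continuous_on {0..1/4} (\<lambda>t. u (of_real t))"
    by (rule continuous_on_compose2[OF holomorphic_on_imp_continuous_on[OF hol]])
       (auto intro!: continuous_intros)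
  have J0: "J \<ge> 0" unfolding J_def by (intro integral_nonneg integrable_continuous_real continuous_intros cont) auto
  have "\<exists>x\<in>{2 * real i * h..2 * real i * h + h}. h * norm (u (of_real x)) \<le> J" if "i \<le> n" for i
  proof -
    have "2 * real i * h + h = (2 * real i + 1) * h" by (simp add: algebra_simps)
    also have "\<dots> \<le> (2 * N) * h" using that h0 by (intro mult_right_mono) (auto simp: N_def)
    also have "\<dots> = 1 / 4" using N by (simp add: h_def)
    finally show ?thesis
      using exists_point_le_integral[OF cont, of "2 * real i * h" "2 * real i * h + h"] h0
      by (auto simp: J_def)
  qed
  then obtain x where x: "\<And>i. i \<le> n \<Longrightarrow> x i \<in> {2 * real i * h..2 * real i * h + h}"
      "\<And>i. i \<le> n \<Longrightarrow> h * norm (u (of_real (x i))) \<le> J"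
    by metis
  have x1: "\<bar>x i\<bar> \<le> 1" if "i \<le> n" for i
  proof -
    have "x i \<le> (2 * real i + 1) * h" using x(1)[OF that] by (simp add: algebra_simps)
    also have "\<dots> \<le> (2 * N) * h" using that h0 by (intro mult_right_mono) (auto simp: N_def)
    also have "\<dots> = 1 / 4" using N by (simp add: h_def)
    finally have "x i \<le> 1" by simp
    moreover have "0 \<le> 2 * real i * h" using h0 by simp
    then have "0 \<le> x i" using x(1)[OF that] unfolding atLeastAtMost_iff by linarith
    ultimately show ?thesis by simp
  qed
  have sep1: "(real j - real i) * h \<le> x j - x i" if "i < j" "j \<le> n" for i j
  proof -
    have "1 * h \<le> (real j - real i) * h" using that h0 by (intro mult_right_mono) auto
    then have "(real j - real i) * h \<le> 2 * real j * h - (2 * real i * h + h)" by (simp add: algebra_simps)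
    then show ?thesis using x(1)[of i] x(1)[of j] that by simp
  qed
  have sep: "\<bar>real i - real j\<bar> * h \<le> \<bar>x i - x j\<bar>" if "i \<le> n" "j \<le> n" for i j
    using sep1[of i j] sep1[of j i] that by (cases i j rule: linorder_cases) auto
  have "norm (poly p (of_real (x i))) \<le> 8 * N * (J + \<rho>)" if "i \<le> n" for i
  proof -
    have "norm (poly p (of_real (x i))) \<le> norm (u (of_real (x i))) + \<rho>"
      using p(2)[of "of_real (x i)"] x1[OF that] norm_triangle_sub[of "poly p (of_real (x i))" "u (of_real (x i))"]
      by (simp add: norm_minus_commute)
    also have "\<dots> \<le> 8 * N * J + \<rho>" using x(2)[OF that] N by (simp add: h_def field_simps)
    also have "\<dots> \<le> 8 * N * J + 8 * N * \<rho>"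
      using N rho0 mult_right_mono[of 1 "8 * N" \<rho>] by simp
    finally show ?thesis by (simp add: algebra_simps)
  qed
  then have "norm (poly p z) \<le> (4 / h) ^ n / fact n * (8 * N * (J + \<rho>))"
    using p(1) h0 sep x1 z by (intro poly_norm_le_separated_nodes[where x = x]) auto
  also have "(4 / h) ^ n / fact n = 32 ^ n * (N ^ n / fact n)"
  proof -
    have "4 / h = 32 * N" by (simp add: h_def)
    then show ?thesis by (simp only: power_mult_distrib times_divide_eq_right)
  qed
  also have "\<dots> \<le> 32 ^ n * 3 ^ Suc n"
    using power_Suc_le_fact_exp[of n] by (intro mult_left_mono) (auto simp: N_def field_simps)
  also have "(32::real) ^ n * 3 ^ Suc n \<le> 96 ^ Suc n"
    by (simp flip: power_mult_distrib)
  finally have "norm (poly p z) \<le> 96 ^ Suc n * (8 * N * (J + \<rho>))"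
    using J0 rho0 N by (simp add: mult_right_mono)
  moreover have "norm (u z) \<le> norm (poly p z) + \<rho>"
    using p(2)[OF z] norm_triangle_sub[of "u z" "poly p z"] by simp
  moreover have "\<rho> \<le> 96 ^ Suc n * (J + \<rho>)"
    using mult_mono[of 1 "96 ^ Suc n" \<rho> "J + \<rho>"] rho0 J0 by (simp del: power_Suc)
  ultimately have "norm (u z) \<le> 96 ^ Suc n * (J + \<rho>) * (8 * N + 1)"
    by (simp add: algebra_simps)
  also have "8 * N + 1 \<le> 16 ^ Suc n"
  proof -
    have "1 + real (Suc n) * 15 \<le> (1 + 15) ^ Suc n" by (rule Bernoulli_inequality) simp
    then show ?thesis by (simp add: N_def)
  qed
  finally have "norm (u z) \<le> 96 ^ Suc n * (J + \<rho>) * 16 ^ Suc n"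
    using J0 rho0 by (simp add: mult_left_mono)
  also have "\<dots> = (96 * 16) ^ Suc n * (J + \<rho>)" by (simp only: power_mult_distrib mult_ac)
  finally show ?thesis by (simp add: J_def \<rho>_def)
qed

section \<open>Two entire functions with nearly equal moduli\<close>

text \<open>Choosing \<open>n\<close> such that \<open>B ^ (2 * n)\<close> is comparable to \<open>K / E\<close> balances the two summands; each
is then at most a multiple of the geometric mean of \<open>K\<close> and \<open>E\<close>.\<close>

lemma square_le_of_geometric_tradeoff:
  fixes d E K M B :: real
  assumes B: "B > 1" and E: "0 \<le> E" "E \<le> K" and d: "0 \<le> d" and M: "M > 0"
    and bound: "\<And>n. d \<le> M * (B ^ n * E + K / B ^ n)"
  shows "d\<^sup>2 \<le> (M * (1 + B))\<^sup>2 * (K * E)"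
proof (cases "E = 0")
  case True
  have "(\<lambda>n. M * K * inverse (B ^ n)) \<longlonglongrightarrow> M * K * 0"
    using B by (intro tendsto_mult tendsto_const LIMSEQ_inverse_realpow_zero)
  moreover have "d \<le> M * K * inverse (B ^ n)" for n
    using bound[of n] True by (simp add: divide_inverse mult.assoc)
  ultimately have "d \<le> 0" by (intro LIMSEQ_le_const) auto
  then show ?thesis using d True by simp
next
  case False
  then have E0: "E > 0" "K > 0" using E by auto
  define P where "P k \<longleftrightarrow> K / E < B ^ (2 * k)" for k
  obtain k where "K / E < (B\<^sup>2) ^ k"
    using real_arch_pow[of "B\<^sup>2" "K / E"] B by (auto simp: one_less_power)
  then have "P k" by (simp add: P_def power_mult)
  moreover have "\<not> P 0" using E E0 by (simp add: P_def field_simps)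
  ultimately obtain n where n: "\<not> P n" "P (Suc n)"
    using ex_least_nat_less[of P k] by auto
  have Bn: "B ^ n > 0" using B by simp
  have B2: "B ^ (2 * n) = (B ^ n)\<^sup>2" by (simp add: power_even_eq)
  have "(B ^ n * E)\<^sup>2 = B ^ (2 * n) * E\<^sup>2" by (simp add: B2 power_mult_distrib)
  also have "\<dots> \<le> K / E * E\<^sup>2" using n(1) by (intro mult_right_mono) (auto simp: P_def)
  finally have "(B ^ n * E)\<^sup>2 \<le> K * E" using E0 by (simp add: power2_eq_square)
  then have first: "B ^ n * E \<le> sqrt (K * E)" by (rule real_le_rsqrt)
  have "K < B ^ (2 * n) * B\<^sup>2 * E"
    using n(2) E0 by (simp add: P_def field_simps power2_eq_square)
  then have "K * K \<le> B ^ (2 * n) * B\<^sup>2 * E * K" using E0 by (intro mult_right_mono) auto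
  then have "(K / B ^ n)\<^sup>2 \<le> B\<^sup>2 * (K * E)"
    unfolding B2 using Bn by (simp add: power_divide divide_le_eq power2_eq_square mult_ac)
  then have "K / B ^ n \<le> sqrt (B\<^sup>2 * (K * E))" by (rule real_le_rsqrt)
  then have second: "K / B ^ n \<le> B * sqrt (K * E)" using B by (simp add: real_sqrt_mult)
  have "d \<le> M * (B ^ n * E + K / B ^ n)" by (rule bound)
  also have "\<dots> \<le> M * (sqrt (K * E) + B * sqrt (K * E))"
    using first second M by (intro mult_left_mono add_mono) auto
  finally have "d \<le> M * (1 + B) * sqrt (K * E)" by (simp add: algebra_simps)
  then have "d\<^sup>2 \<le> (M * (1 + B) * sqrt (K * E))\<^sup>2" using d by (intro power_mono)
  then show ?thesis using E0 by (simp add: power_mult_distrib)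
qed

text \<open>The function \<open>H \<xi> \<eta>\<close> in the proof is entire in both variables. For real arguments it is the
difference of the squared moduli at \<open>\<xi> + \<i> \<eta>\<close>; a general pair \<open>(z, w)\<close> is reached at the
complex arguments \<open>\<xi> = (z + cnj w) / 2\<close> and \<open>\<eta> = (z - cnj w) / (2 * \<i>)\<close>, again of modulus at most one.
Smallness is thus transported from the real square first in \<open>\<eta>\<close> and then in \<open>\<xi>\<close>. The two
applications cost \<open>A ^ (2 * n)\<close>, while the error is \<open>K / R ^ n\<close>; the radius \<open>R = A ^ 4\<close> makes the
products \<open>(A\<^sup>2) ^ n * E\<close> and \<open>K / (A\<^sup>2) ^ n\<close> symmetric, hence the exponent one half. On the bidisc of radius
\<open>R\<close> the arguments of \<open>F\<close> and \<open>G\<close> stay within radius \<open>2 * R\<close>.\<close>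

lemma polarized_difference_bound:
  fixes F G :: "complex \<Rightarrow> complex"
  defines "E \<equiv> integral (cbox (0, 0) (1/4, 1/4))
                  (\<lambda>(x, y). \<bar>(norm (F (Complex x y)))\<^sup>2 - (norm (G (Complex x y)))\<^sup>2\<bar>)"
  assumes F: "F holomorphic_on UNIV" and G: "G holomorphic_on UNIV"
    and K: "\<And>z w. norm z \<le> 2 * 1536 ^ 4 \<Longrightarrow> norm w \<le> 2 * 1536 ^ 4 \<Longrightarrow>
              norm (F z) * norm (F w) + norm (G z) * norm (G w) \<le> K"
    and z: "norm z \<le> 1" and w: "norm w \<le> 1"
  shows "(norm (F z * cnj (F w) - G z * cnj (G w)))\<^sup>2
           \<le> (2 * 1536\<^sup>2 * (1 + 1536\<^sup>2))\<^sup>2 * (K * E)"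
proof -
  define A :: real where "A = 1536"
  define R :: real where "R = A ^ 4"
  define H where "H \<xi> \<eta> = F (\<xi> + \<i> * \<eta>) * cnj (F (cnj (\<xi> - \<i> * \<eta>)))
                        - G (\<xi> + \<i> * \<eta>) * cnj (G (cnj (\<xi> - \<i> * \<eta>)))" for \<xi> \<eta>
  have R2: "R \<ge> 2" by (simp add: R_def A_def)
  have A1: "A \<ge> 1" by (simp add: A_def)
  have conj_hol: "(\<lambda>z. cnj (f (cnj z))) holomorphic_on UNIV" if "f holomorphic_on UNIV" for f
    using holomorphic_on_compose_cnj_cnj[OF holomorphic_on_subset[OF that], of UNIV] by (simp add: o_def)
  have comp: "(\<lambda>z. f (g z)) holomorphic_on UNIV"
    if "f holomorphic_on UNIV" "g holomorphic_on UNIV" for f g :: "complex \<Rightarrow> complex"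
    using holomorphic_on_compose_gen[OF that(2) that(1)] by (simp add: o_def)
  have H1: "(\<lambda>\<xi>. H \<xi> \<eta>) holomorphic_on UNIV" for \<eta>
    unfolding H_def
    by (intro holomorphic_intros comp[OF F] comp[OF G] comp[OF conj_hol[OF F]] comp[OF conj_hol[OF G]])
  have H2: "(\<lambda>\<eta>. H \<xi> \<eta>) holomorphic_on UNIV" for \<xi>
    unfolding H_def
    by (intro holomorphic_intros comp[OF F] comp[OF G] comp[OF conj_hol[OF F]] comp[OF conj_hol[OF G]])
  have HK: "norm (H \<xi> \<eta>) \<le> K" if "norm \<xi> \<le> R" "norm \<eta> \<le> R" for \<xi> \<eta>
  proof -
    have a: "norm (\<xi> + \<i> * \<eta>) \<le> 2 * 1536 ^ 4"
      using norm_triangle_ineq[of \<xi> "\<i> * \<eta>"] that by (simp add: norm_mult R_def A_def)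
    have b: "norm (cnj (\<xi> - \<i> * \<eta>)) \<le> 2 * 1536 ^ 4"
      unfolding complex_mod_cnj
      using norm_triangle_ineq4[of \<xi> "\<i> * \<eta>"] that by (simp add: norm_mult R_def A_def)
    have "norm (H \<xi> \<eta>) \<le> norm (F (\<xi> + \<i> * \<eta>)) * norm (F (cnj (\<xi> - \<i> * \<eta>)))
              + norm (G (\<xi> + \<i> * \<eta>)) * norm (G (cnj (\<xi> - \<i> * \<eta>)))"
      unfolding H_def by (rule order_trans[OF norm_triangle_ineq4]) (simp add: norm_mult)
    also have "\<dots> \<le> K" by (rule K[OF a b])
    finally show ?thesis .
  qed
  have K0: "K \<ge> 0" using HK[of 0 0] R2 norm_ge_zero[of "H 0 0"] by (simp del: norm_ge_zero)
  have Hdiag: "norm (H (of_real x) (of_real y))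
      = \<bar>(norm (F (Complex x y)))\<^sup>2 - (norm (G (Complex x y)))\<^sup>2\<bar>" for x y
  proof -
    have e: "complex_of_real x + \<i> * complex_of_real y = Complex x y"
      "cnj (complex_of_real x - \<i> * complex_of_real y) = Complex x y"
      by (simp_all add: complex_eq_iff)
    have "H (of_real x) (of_real y)
        = of_real ((norm (F (Complex x y)))\<^sup>2 - (norm (G (Complex x y)))\<^sup>2)"
      unfolding H_def e by (simp only: complex_norm_square of_real_diff)
    then show ?thesis by (simp only: norm_of_real)
  qed
  have contF: "continuous_on UNIV F" and contG: "continuous_on UNIV G"
    using F G by (auto intro: holomorphic_on_imp_continuous_on)
  have contH: "continuous_on S (\<lambda>p. H (f p) (g p))"
    if "continuous_on S f" "continuous_on S g" for S :: "'a::topological_space set" and f g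
    unfolding H_def
    by (intro continuous_intros that continuous_on_compose2[OF contF] continuous_on_compose2[OF contG]) auto
  have E_eq: "E = integral {0..1/4} (\<lambda>x. integral {0..1/4} (\<lambda>y. norm (H (of_real x) (of_real y))))"
  proof -
    have "continuous_on (cbox (0, 0) (1/4, 1/4))
            (\<lambda>p::real\<times>real. norm (H (of_real (fst p)) (of_real (snd p))))"
      by (intro continuous_intros contH)
    then have "integral (cbox (0, 0) (1/4, 1/4)) (\<lambda>p::real\<times>real. norm (H (of_real (fst p)) (of_real (snd p))))
      = integral {0..1/4} (\<lambda>x. integral {0..1/4} (\<lambda>y. norm (H (of_real x) (of_real y))))"
      by (subst integral_prod_continuous) auto
    then show ?thesis unfolding E_def Hdiag[symmetric] by (simp add: case_prod_unfold)
  qed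
  have cont_inner: "continuous_on {0..1/4} (\<lambda>x. integral {0..1/4} (\<lambda>y. norm (H (of_real x) (of_real y))))"
  proof -
    have "continuous_on ({0..1/4} \<times> cbox 0 (1/4)) (\<lambda>(x::real, y::real). norm (H (of_real x) (of_real y)))"
      unfolding case_prod_unfold by (intro continuous_intros contH)
    then show ?thesis using integral_continuous_on_param by (fastforce simp: cbox_interval)
  qed
  have int_y: "(\<lambda>y. norm (H \<xi> (of_real y))) integrable_on {0..1/4}" for \<xi>
    by (intro integrable_continuous_real continuous_intros contH)
  have int_x: "(\<lambda>x. norm (H (of_real x) \<eta>)) integrable_on {0..1/4}" for \<eta>
    by (intro integrable_continuous_real continuous_intros contH)
  have inner0: "0 \<le> integral {0..1/4} (\<lambda>y. norm (H (of_real x) (of_real y)))" for x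
    by (intro integral_nonneg int_y) auto
  have E0: "0 \<le> E"
    unfolding E_eq by (intro integral_nonneg integrable_continuous_real cont_inner inner0)
  have EK: "E \<le> K"
  proof -
    have "integral {0..1/4} (\<lambda>y. norm (H (of_real x) (of_real y))) \<le> K / 4" if "x \<in> {0..1/4}" for x
    proof -
      have "integral {0..1/4} (\<lambda>y. norm (H (of_real x) (of_real y))) \<le> integral {0..1/4} (\<lambda>y::real. K)"
        using that R2 by (intro integral_le int_y HK) auto
      then show ?thesis by simp
    qed
    then have "E \<le> integral {0..1/4} (\<lambda>x::real. K / 4)"
      unfolding E_eq by (intro integral_le integrable_continuous_real cont_inner) auto
    then show ?thesis using K0 by simp
  qed
  have bound: "norm (H \<xi> \<eta>) \<le> 2 * A\<^sup>2 * ((A\<^sup>2) ^ n * E + K / (A\<^sup>2) ^ n)"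
    if \<xi>: "norm \<xi> \<le> 1" and \<eta>: "norm \<eta> \<le> 1" for \<xi> \<eta> n
  proof -
    define \<rho> where "\<rho> = K / R ^ n"
    have rho0: "\<rho> \<ge> 0" using K0 R2 by (simp add: \<rho>_def)
    have An: "A ^ Suc n \<ge> 1" using A1 by (rule one_le_power)
    have inner: "norm (H (of_real x) \<eta>)
        \<le> A ^ Suc n * (integral {0..1/4} (\<lambda>y. norm (H (of_real x) (of_real y))) + \<rho>)"
      if "x \<in> {0..1/4}" for x
      unfolding A_def \<rho>_def
      by (rule entire_norm_le_segment_integral[OF H2 R2 _ \<eta>]) (use that R2 in \<open>auto intro: HK\<close>)
    have outer: "norm (H \<xi> \<eta>) \<le> A ^ Suc n * (integral {0..1/4} (\<lambda>x. norm (H (of_real x) \<eta>)) + \<rho>)"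
      unfolding A_def \<rho>_def
      by (rule entire_norm_le_segment_integral[OF H1 R2 _ \<xi>]) (use \<eta> R2 in \<open>auto intro: HK\<close>)
    have int_sum: "(\<lambda>x. integral {0..1/4} (\<lambda>y. norm (H (of_real x) (of_real y)))) integrable_on {0..1/4}"
      by (intro integrable_continuous_real cont_inner)
    have "integral {0..1/4} (\<lambda>x. norm (H (of_real x) \<eta>))
        \<le> integral {0..1/4} (\<lambda>x. A ^ Suc n * (integral {0..1/4} (\<lambda>y. norm (H (of_real x) (of_real y))) + \<rho>))"
      by (intro integral_le int_x inner integrable_continuous_real continuous_intros cont_inner)
    also have "\<dots> = A ^ Suc n * (E + \<rho> / 4)"
      unfolding E_eq integral_mult_right by (subst integral_add[OF int_sum]) auto
    also have "\<dots> \<le> A ^ Suc n * (E + \<rho>)" using An rho0 by (intro mult_left_mono) auto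
    finally have "norm (H \<xi> \<eta>) \<le> A ^ Suc n * (A ^ Suc n * (E + \<rho>) + \<rho>)"
      using An by (intro order_trans[OF outer] mult_left_mono add_right_mono) auto
    also have "\<dots> \<le> A ^ Suc n * (A ^ Suc n * (E + \<rho>) + A ^ Suc n * \<rho>)"
      using An rho0 mult_right_mono[of 1 "A ^ Suc n" \<rho>] by (intro mult_left_mono add_left_mono) auto
    also have "\<dots> = (A ^ Suc n)\<^sup>2 * (E + 2 * \<rho>)" by (simp add: power2_eq_square algebra_simps)
    also have "\<dots> \<le> (A ^ Suc n)\<^sup>2 * (2 * (E + \<rho>))" using E0 by (intro mult_left_mono) auto
    also have "(A ^ Suc n)\<^sup>2 = A\<^sup>2 * (A\<^sup>2) ^ n" by (metis power_Suc power_commutes power_even_eq power_mult)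
    also have "A\<^sup>2 * (A\<^sup>2) ^ n * (2 * (E + \<rho>)) = 2 * A\<^sup>2 * ((A\<^sup>2) ^ n * E + (A\<^sup>2) ^ n * \<rho>)"
      by (simp add: algebra_simps)
    also have "(A\<^sup>2) ^ n * \<rho> = K / (A\<^sup>2) ^ n"
    proof -
      have "R ^ n = (A\<^sup>2) ^ n * (A\<^sup>2) ^ n"
        unfolding R_def by (simp flip: power_mult power_add)
      then show ?thesis using A1 by (simp add: \<rho>_def)
    qed
    finally show ?thesis .
  qed
  define \<xi> where "\<xi> = (z + cnj w) / 2"
  define \<eta> where "\<eta> = (z - cnj w) / (2 * \<i>)"
  have sum: "\<xi> + \<i> * \<eta> = z" by (simp add: \<xi>_def \<eta>_def field_simps)
  have diff: "\<xi> - \<i> * \<eta> = cnj w" by (simp add: \<xi>_def \<eta>_def field_simps)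
  have xi1: "norm \<xi> \<le> 1" using norm_triangle_ineq[of z "cnj w"] z w by (simp add: \<xi>_def norm_divide)
  have eta1: "norm \<eta> \<le> 1" using norm_triangle_ineq4[of z "cnj w"] z w by (simp add: \<eta>_def norm_divide norm_mult)
  have "H \<xi> \<eta> = F z * cnj (F w) - G z * cnj (G w)" unfolding H_def sum diff by simp
  moreover have "(norm (H \<xi> \<eta>))\<^sup>2 \<le> (2 * A\<^sup>2 * (1 + A\<^sup>2))\<^sup>2 * (K * E)"
    by (rule square_le_of_geometric_tradeoff[OF _ E0 EK _ _ bound[OF xi1 eta1]]) (auto simp: A_def)
  ultimately show ?thesis by (simp add: A_def)
qed

section \<open>The Bargmann transform\<close>

lemma mult_le_sum_squares:
  fixes x y :: real
  assumes "0 \<le> x" "0 \<le> y"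
  shows "x * y \<le> x\<^sup>2 + y\<^sup>2"
  using sum_squares_bound[of x y] mult_nonneg_nonneg[OF assms] by linarith

lemma has_bochner_integral_gaussian:
  "has_bochner_integral lebesgue (\<lambda>t. exp (- pi * (t - x)\<^sup>2)) 1"
proof -
  \<comment> \<open>The normal density with this standard deviation has normalising factor one.\<close>
  define \<sigma> where "\<sigma> = 1 / sqrt (2 * pi)"
  have \<sigma>: "\<sigma> > 0" by (simp add: \<sigma>_def)
  have dens: "normal_density x \<sigma> = (\<lambda>t. exp (- pi * (t - x)\<^sup>2))"
    by (rule ext) (simp add: normal_density_def \<sigma>_def power_divide)
  have "integrable lborel (normal_density x \<sigma>)" "integral\<^sup>L lborel (normal_density x \<sigma>) = 1"
    using \<sigma> by (auto intro: integrable_normal_density integral_normal_density)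
  then show ?thesis
    unfolding dens has_bochner_integral_iff
    by (simp add: integrable_completion integral_completion)
qed

lemma integrable_gaussian: "integrable lebesgue (\<lambda>t. exp (- pi * (t - x)\<^sup>2))"
  using has_bochner_integral_gaussian[of x] by (simp add: has_bochner_integral_iff)

lemma square_integrable_measurable:
  "square_integrable f \<Longrightarrow> f \<in> borel_measurable lebesgue"
  by (simp add: square_integrable_def)

lemma lebesgue_borel_ident_measurable [measurable]:
  "(\<lambda>t::real. t) \<in> lebesgue \<rightarrow>\<^sub>M borel"
  by (simp add: measurable_completion)

lemma measurable_cnj [measurable]: "cnj \<in> borel \<rightarrow>\<^sub>M borel"
  by (intro borel_measurable_continuous_onI continuous_intros)

lemma measurable_complex_of_real [measurable]: "complex_of_real \<in> borel \<rightarrow>\<^sub>M borel"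
  by (intro borel_measurable_continuous_onI continuous_intros)

lemma integrable_gaussian_exponential_weight:
  assumes f: "square_integrable f" and \<rho>: "\<rho> \<ge> 0"
  shows "integrable lebesgue (\<lambda>t. norm (f t) * exp (- pi * t\<^sup>2) * exp (2 * pi * \<rho> * \<bar>t\<bar>))"
proof (rule Bochner_Integration.integrable_bound)
  have "integrable lebesgue (\<lambda>t::real. exp (- pi * t\<^sup>2))" using integrable_gaussian[of 0] by simp
  then show "integrable lebesgue (\<lambda>t. (norm (f t))\<^sup>2 + exp (4 * pi * \<rho>\<^sup>2) * exp (- pi * t\<^sup>2))"
    using f by (intro Bochner_Integration.integrable_add integrable_mult_right) (auto simp: square_integrable_def)
  note [measurable] = square_integrable_measurable[OF f]
  show "(\<lambda>t. norm (f t) * exp (- pi * t\<^sup>2) * exp (2 * pi * \<rho> * \<bar>t\<bar>)) \<in> borel_measurable lebesgue"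
    by measurable
  show "AE t in lebesgue. norm (norm (f t) * exp (- pi * t\<^sup>2) * exp (2 * pi * \<rho> * \<bar>t\<bar>))
        \<le> norm ((norm (f t))\<^sup>2 + exp (4 * pi * \<rho>\<^sup>2) * exp (- pi * t\<^sup>2))"
  proof (intro AE_I2)
    fix t :: real
    define w where "w = exp (- pi * t\<^sup>2 + 2 * pi * \<rho> * \<bar>t\<bar>)"
    have w0: "w > 0" by (simp add: w_def)
    have "w\<^sup>2 = exp (2 * (- pi * t\<^sup>2 + 2 * pi * \<rho> * \<bar>t\<bar>))" unfolding w_def exp_double ..
    also have "\<dots> \<le> exp (4 * pi * \<rho>\<^sup>2 - pi * t\<^sup>2)"
    proof -
      have "0 \<le> pi * (\<bar>t\<bar> - 2 * \<rho>)\<^sup>2" by simp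
      then show ?thesis by (simp add: power2_diff algebra_simps)
    qed
    finally have "w\<^sup>2 \<le> exp (4 * pi * \<rho>\<^sup>2) * exp (- pi * t\<^sup>2)" by (simp flip: exp_add)
    moreover have "norm (f t) * w \<le> (norm (f t))\<^sup>2 + w\<^sup>2"
      using w0 by (intro mult_le_sum_squares) auto
    ultimately have "norm (f t) * w \<le> (norm (f t))\<^sup>2 + exp (4 * pi * \<rho>\<^sup>2) * exp (- pi * t\<^sup>2)"
      by linarith
    moreover have eq: "norm (f t) * exp (- pi * t\<^sup>2) * exp (2 * pi * \<rho> * \<bar>t\<bar>) = norm (f t) * w"
      unfolding w_def exp_add by (simp add: mult.assoc)
    ultimately show "norm (norm (f t) * exp (- pi * t\<^sup>2) * exp (2 * pi * \<rho> * \<bar>t\<bar>))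
        \<le> norm ((norm (f t))\<^sup>2 + exp (4 * pi * \<rho>\<^sup>2) * exp (- pi * t\<^sup>2))"
      unfolding eq using w0 by (simp add: abs_mult)
  qed
qed

text \<open>The signal is conjugated so that the point \<open>(x, y)\<close> of the time-frequency plane corresponds to \<open>x + \<i> y\<close>;
without the conjugation it would be \<open>x - \<i> y\<close>. The Gaussian factor that the usual Bargmann
transform carries in \<open>\<zeta>\<close> is left out: here the growth in \<open>Re \<zeta>\<close> alone is \<open>exp (pi * (Re \<zeta>)\<^sup>2)\<close>.\<close>

definition bargmann :: "(real \<Rightarrow> complex) \<Rightarrow> complex \<Rightarrow> complex" where
  "bargmann f \<zeta> = (LINT t|lebesgue. cnj (f t) * of_real (exp (- pi * t\<^sup>2)) * exp (2 * of_real pi * \<zeta> * of_real t))"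

text \<open>The exponential is expanded and integrated termwise; the sum of the absolute values is dominated
by the weight of \<open>integrable_gaussian_exponential_weight\<close>.\<close>

lemma bargmann_power_series:
  assumes f: "square_integrable f"
  shows "\<exists>m. \<forall>\<zeta>. (\<lambda>n. m n * \<zeta> ^ n) sums bargmann f \<zeta>"
proof -
  note [measurable] = square_integrable_measurable[OF f]
  define k where "k t = cnj (f t) * of_real (exp (- pi * t\<^sup>2))" for t
  have k_meas [measurable]: "k \<in> borel_measurable lebesgue" unfolding k_def by measurable
  have k_norm: "norm (k t) = norm (f t) * exp (- pi * t\<^sup>2)" for t
    by (simp add: k_def norm_mult)
  define m where "m n = (LINT t|lebesgue. k t * ((2 * of_real pi * of_real t) ^ n / fact n))" for n
  have "(\<lambda>n. m n * \<zeta> ^ n) sums bargmann f \<zeta>" for \<zeta>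
  proof -
    define u where "u n t = k t * ((2 * of_real pi * \<zeta> * of_real t) ^ n / fact n)" for n and t :: real
    define v where "v t = norm (f t) * exp (- pi * t\<^sup>2) * exp (2 * pi * norm \<zeta> * \<bar>t\<bar>)" for t
    have v: "integrable lebesgue v"
      unfolding v_def by (rule integrable_gaussian_exponential_weight[OF f]) simp
    have u_norm: "norm (u n t) = norm (k t) * ((2 * pi * norm \<zeta> * \<bar>t\<bar>) ^ n / fact n)" for n t
      by (simp add: u_def norm_mult norm_divide norm_power)
    have exp_sums: "(\<lambda>n. (2 * pi * norm \<zeta> * \<bar>t\<bar>) ^ n / fact n) sums exp (2 * pi * norm \<zeta> * \<bar>t\<bar>)" for t
      using exp_converges[of "2 * pi * norm \<zeta> * \<bar>t\<bar>"] by (simp add: divide_inverse_commute)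
    have u_sums: "(\<lambda>n. norm (u n t)) sums v t" for t
      unfolding u_norm v_def k_norm by (intro sums_mult exp_sums)
    have part: "(\<Sum>i<n. norm (u i t)) \<le> v t" for n t
      using sum_le_suminf[of "\<lambda>n. norm (u n t)" "{..<n}"] u_sums[of t] by (auto simp: sums_iff)
    have u_meas [measurable]: "u n \<in> borel_measurable lebesgue" for n unfolding u_def by measurable
    have u_int: "integrable lebesgue (u n)" for n
    proof (rule Bochner_Integration.integrable_bound[OF v u_meas])
      have "norm (u n t) \<le> v t" for t
        using part[of t "Suc n"] sum_nonneg[of "{..<n}" "\<lambda>i. norm (u i t)"] by simp
      then show "AE t in lebesgue. norm (u n t) \<le> norm (v t)"
        by (intro AE_I2) (metis abs_ge_self order_trans real_norm_def)
    qed
    have sum_int: "summable (\<lambda>n. LINT t|lebesgue. norm (u n t))"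
    proof (rule summableI_nonneg_bounded)
      fix n
      have "(\<Sum>i<n. LINT t|lebesgue. norm (u i t)) = (LINT t|lebesgue. (\<Sum>i<n. norm (u i t)))"
        by (rule Bochner_Integration.integral_sum[symmetric]) (use u_int in auto)
      also have "\<dots> \<le> (LINT t|lebesgue. v t)"
        using u_int v part by (intro integral_mono Bochner_Integration.integrable_sum integrable_norm) auto
      finally show "(\<Sum>i<n. LINT t|lebesgue. norm (u i t)) \<le> (LINT t|lebesgue. v t)" .
    qed auto
    have "(\<lambda>n. integral\<^sup>L lebesgue (u n)) sums (LINT t|lebesgue. (\<Sum>n. u n t))"
      using u_int sum_int u_sums by (intro sums_integral) (auto simp: sums_iff)
    moreover have "integral\<^sup>L lebesgue (u n) = m n * \<zeta> ^ n" for n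
    proof -
      have "u n = (\<lambda>t. (k t * ((2 * of_real pi * of_real t) ^ n / fact n)) * \<zeta> ^ n)"
        by (rule ext) (simp add: u_def power_mult_distrib mult_ac)
      then show ?thesis by (simp add: m_def)
    qed
    moreover have "(\<Sum>n. u n t) = k t * exp (2 * of_real pi * \<zeta> * of_real t)" for t
    proof -
      have "(\<lambda>n. u n t) sums (k t * exp (2 * of_real pi * \<zeta> * of_real t))"
        unfolding u_def using exp_converges[of "2 * of_real pi * \<zeta> * of_real t"]
        by (intro sums_mult) (simp add: scaleR_conv_of_real divide_inverse_commute)
      then show ?thesis by (simp add: sums_iff)
    qed
    ultimately show ?thesis by (simp add: bargmann_def k_def)
  qed
  then show ?thesis by blast
qed

lemma bargmann_holomorphic:
  assumes "square_integrable f"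
  shows "bargmann f holomorphic_on UNIV"
proof -
  obtain m where m: "\<And>\<zeta>. (\<lambda>n. m n * \<zeta> ^ n) sums bargmann f \<zeta>"
    using bargmann_power_series[OF assms] by blast
  have "bargmann f holomorphic_on ball 0 r" for r
    by (rule power_series_holomorphic[of 0 r m]) (use m in simp)
  then have "bargmann f analytic_on {z}" for z
    unfolding analytic_at by (meson ball_eq_empty centre_in_ball open_ball mem_ball_0 gt_ex)
  then show ?thesis by (meson analytic_imp_holomorphic analytic_on_analytic_at)
qed

lemma cnj_gabor_eq_bargmann:
  "cnj (gabor f (x, y)) = of_real (exp (- pi * x\<^sup>2)) * bargmann f (Complex x y)"
proof -
  have "cnj (gabor f (x, y)) = (LINT t|lebesgue. cnj (f t * of_real (exp (- pi * (t - x)\<^sup>2))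
      * exp (- 2 * of_real pi * \<i> * of_real t * of_real y)))"
    unfolding gabor_def by (simp del: complex_cnj_mult flip: integral_cnj)
  also have "\<dots> = (LINT t|lebesgue. of_real (exp (- pi * x\<^sup>2)) *
      (cnj (f t) * of_real (exp (- pi * t\<^sup>2)) * exp (2 * of_real pi * Complex x y * of_real t)))"
  proof (rule Bochner_Integration.integral_cong[OF refl])
    fix t :: real
    have "complex_of_real (exp (- pi * (t - x)\<^sup>2)) * cnj (exp (- 2 * of_real pi * \<i> * of_real t * of_real y))
      = exp (of_real (- pi * (t - x)\<^sup>2) + 2 * of_real pi * \<i> * of_real t * of_real y)"
      unfolding exp_add exp_of_real exp_cnj by simp
    also have "of_real (- pi * (t - x)\<^sup>2) + 2 * of_real pi * \<i> * of_real t * of_real y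
      = complex_of_real (- pi * x\<^sup>2) + of_real (- pi * t\<^sup>2) + 2 * of_real pi * Complex x y * of_real t"
      by (simp add: Complex_eq power2_eq_square algebra_simps)
    also have "exp \<dots> = of_real (exp (- pi * x\<^sup>2)) * of_real (exp (- pi * t\<^sup>2)) * exp (2 * of_real pi * Complex x y * of_real t)"
      by (simp only: exp_add exp_of_real)
    finally show "cnj (f t * of_real (exp (- pi * (t - x)\<^sup>2)) * exp (- 2 * of_real pi * \<i> * of_real t * of_real y))
      = of_real (exp (- pi * x\<^sup>2)) *
      (cnj (f t) * of_real (exp (- pi * t\<^sup>2)) * exp (2 * of_real pi * Complex x y * of_real t))"
      by (simp add: mult_ac)
  qed
  finally show ?thesis by (simp only: bargmann_def integral_mult_right_zero)
qed

section \<open>Continuity and boundedness of spectrograms\<close>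

lemma continuous_on_gabor:
  assumes "square_integrable f"
  shows "continuous_on S (gabor f)"
proof -
  have c: "continuous_on UNIV (bargmann f)"
    using bargmann_holomorphic[OF assms] by (rule holomorphic_on_imp_continuous_on)
  have "gabor f = (\<lambda>z. cnj (of_real (exp (- pi * (fst z)\<^sup>2)) * bargmann f (of_real (fst z) + \<i> * of_real (snd z))))"
    by (rule ext) (metis Complex_eq cnj_gabor_eq_bargmann complex_cnj_cnj prod.collapse)
  moreover have "continuous_on S (\<lambda>z. cnj (of_real (exp (- pi * (fst z)\<^sup>2)) * bargmann f (of_real (fst z) + \<i> * of_real (snd z))))"
    by (intro continuous_intros continuous_on_compose2[OF c]) auto
  ultimately show ?thesis by simp
qed

lemma continuous_on_spectrogram:
  "square_integrable f \<Longrightarrow> continuous_on S (spectrogram f)"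
  unfolding spectrogram_def by (intro continuous_intros continuous_on_gabor)

lemma spectrogram_bounded:
  assumes f: "square_integrable f"
  shows "\<exists>B. \<forall>z. spectrogram f z \<le> B"
proof -
  note [measurable] = square_integrable_measurable[OF f]
  define B where "B = (LINT t|lebesgue. (norm (f t))\<^sup>2) + 1"
  have "norm (gabor f (x, y)) \<le> B" for x y
  proof -
    define g where "g t = f t * of_real (exp (- pi * (t - x)\<^sup>2)) * exp (- 2 * of_real pi * \<i> * of_real t * of_real y)" for t
    define b where "b t = (norm (f t))\<^sup>2 + exp (- pi * (t - x)\<^sup>2)" for t
    have b: "has_bochner_integral lebesgue b B"
      unfolding b_def B_def
      by (intro has_bochner_integral_add has_bochner_integral_gaussian has_bochner_integral_integrable)
         (use f in \<open>simp add: square_integrable_def\<close>)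
    have gb: "norm (g t) \<le> b t" for t
    proof -
      define e where "e = exp (- pi * (t - x)\<^sup>2)"
      have e: "0 \<le> e" "e \<le> 1" by (auto simp: e_def)
      have "norm (g t) = norm (f t) * e" by (simp add: g_def norm_mult e_def)
      also have "\<dots> \<le> (norm (f t))\<^sup>2 + e\<^sup>2"
        using e(1) by (intro mult_le_sum_squares) auto
      also have "e\<^sup>2 \<le> e" using e by (simp add: power2_eq_square mult_left_le)
      finally show ?thesis by (simp add: b_def e_def)
    qed
    have "g \<in> borel_measurable lebesgue" unfolding g_def by measurable
    moreover have "integrable lebesgue b" using b by (simp add: has_bochner_integral_iff)
    ultimately have "integrable lebesgue g"
      using gb by (intro Bochner_Integration.integrable_bound[of lebesgue b g] AE_I2)
        (auto intro: order_trans[OF _ abs_ge_self])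
    have "norm (integral\<^sup>L lebesgue g) \<le> (LINT t|lebesgue. norm (g t))"
      by (rule Bochner_Integration.integral_norm_bound)
    also have "\<dots> \<le> integral\<^sup>L lebesgue b"
      using gb \<open>integrable lebesgue b\<close> \<open>integrable lebesgue g\<close> by (intro integral_mono integrable_norm)
    finally have "norm (integral\<^sup>L lebesgue g) \<le> integral\<^sup>L lebesgue b" .
    then show ?thesis using b by (simp add: gabor_def g_def[abs_def] has_bochner_integral_iff)
  qed
  then have "spectrogram f (x, y) \<le> B\<^sup>2" for x y
    unfolding spectrogram_def by (intro power_mono) auto
  then show ?thesis by (metis prod.collapse)
qed

text \<open>Boundedness makes the essential supremum a real number, so that \<open>Linf_norm\<close> does not take its default value;
continuity turns the almost everywhere bound into a bound at every point, because a nonempty open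
set is not negligible.\<close>

lemma continuous_le_Linf_norm:
  fixes S :: "'a::euclidean_space \<Rightarrow> real"
  assumes cont: "continuous_on UNIV S" and nonneg: "\<And>z. 0 \<le> S z" and bdd: "\<And>z. S z \<le> B"
  shows "S z \<le> Linf_norm lebesgue S"
proof -
  define e where "e = esssup lebesgue (\<lambda>z. ereal (norm (S z)))"
  have meas: "(\<lambda>z. ereal (norm (S z))) \<in> borel_measurable lebesgue"
  proof -
    have "S \<in> borel_measurable lebesgue"
      using cont by (intro measurable_completion) (simp add: borel_measurable_continuous_onI)
    then show ?thesis by measurable
  qed
  have le: "e \<le> ereal B"
    unfolding e_def by (rule esssup_I[OF meas]) (use nonneg bdd in auto)
  have "emeasure lebesgue (space lebesgue :: 'a set) \<noteq> 0" by simp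
  then have "esssup lebesgue (\<lambda>z::'a. 0::ereal) = 0" by (rule esssup_const)
  moreover have "esssup lebesgue (\<lambda>z::'a. 0::ereal) \<le> e"
    unfolding e_def by (rule esssup_mono) auto
  ultimately have "0 \<le> e" by simp
  with le obtain r where r: "e = ereal r" by (cases e) auto
  have "AE z in lebesgue. ereal (norm (S z)) \<le> e" unfolding e_def by (rule esssup_AE)
  then have "AE z in lebesgue. S z \<le> r" using nonneg by (simp add: r)
  then obtain N where N: "{z. \<not> S z \<le> r} \<subseteq> N" "N \<in> null_sets lebesgue"
    by (elim AE_E3) auto
  then have "negligible {z. r < S z}"
    by (metis (no_types, lifting) negligible_iff_null_sets negligible_subset not_le Collect_cong)
  moreover have "open {z. r < S z}" using cont by (intro open_Collect_less continuous_intros)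
  ultimately have "{z. r < S z} = {}" using open_not_negligible by blast
  then have "S z \<le> r" using not_le by blast
  moreover have "Linf_norm lebesgue S = real_of_ereal e"
    unfolding Linf_norm_def e_def ..
  ultimately show ?thesis using r by simp
qed

lemma spectrogram_le_Linf_norm:
  assumes "square_integrable f"
  shows "spectrogram f z \<le> Linf_norm lebesgue (spectrogram f)"
proof -
  obtain B where "\<And>z. spectrogram f z \<le> B" using spectrogram_bounded[OF assms] by blast
  then show ?thesis
    by (intro continuous_le_Linf_norm continuous_on_spectrogram[OF assms])
       (auto simp: spectrogram_def)
qed

section \<open>Recentring\<close>

text \<open>The Bargmann transform of the time-frequency shift of the signal that moves \<open>c\<close> to the origin, up to a
constant phase. The exponential factor restores the weight \<open>exp (- pi * a\<^sup>2)\<close> of the uncentred case, so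
that all bounds below are uniform in the centre.\<close>

definition local_bargmann :: "(real \<Rightarrow> complex) \<Rightarrow> real \<times> real \<Rightarrow> complex \<Rightarrow> complex" where
  "local_bargmann f c \<zeta> = bargmann f (Complex (fst c) (snd c) + \<zeta>)
     * exp (- (2 * of_real (pi * fst c) * \<zeta>) - of_real (pi * (fst c)\<^sup>2))"

lemma local_bargmann_holomorphic:
  assumes "square_integrable f"
  shows "local_bargmann f c holomorphic_on UNIV"
proof -
  have "bargmann f \<circ> (\<lambda>\<zeta>. Complex (fst c) (snd c) + \<zeta>) holomorphic_on UNIV"
    by (rule holomorphic_on_compose_gen[OF _ bargmann_holomorphic[OF assms]])
       (auto intro!: holomorphic_intros)
  then show ?thesis
    unfolding local_bargmann_def o_def by (intro holomorphic_intros)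
qed

text \<open>Weight and phase do not depend on \<open>f\<close>. The phase does depend on the point, which is harmless for
products of a Gabor transform with the conjugate of another value of the same transform.\<close>

lemma cnj_gabor_eq_local_bargmann:
  "cnj (gabor f (c + (a, b)))
     = of_real (exp (- pi * a\<^sup>2)) * cis (2 * pi * fst c * b) * local_bargmann f c (Complex a b)"
proof -
  obtain p q where c: "c = (p, q)" by (cases c)
  have "complex_of_real (exp (- pi * (p + a)\<^sup>2)) = exp (of_real (- pi * (p + a)\<^sup>2))"
    by (simp only: exp_of_real)
  also have "of_real (- pi * (p + a)\<^sup>2) = of_real (- pi * a\<^sup>2) + \<i> * of_real (2 * pi * p * b)
     + (- (2 * of_real (pi * p) * Complex a b) - of_real (pi * p\<^sup>2))"
    by (simp add: Complex_eq power2_eq_square algebra_simps)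
  also have "exp \<dots> = of_real (exp (- pi * a\<^sup>2)) * cis (2 * pi * p * b)
     * exp (- (2 * of_real (pi * p) * Complex a b) - of_real (pi * p\<^sup>2))"
    by (simp only: exp_add exp_of_real cis_conv_exp)
  finally show ?thesis
    by (simp add: c cnj_gabor_eq_bargmann local_bargmann_def complex_add mult_ac)
qed

lemma norm_gabor_eq_local_bargmann:
  "norm (gabor f (c + (a, b))) = exp (- pi * a\<^sup>2) * norm (local_bargmann f c (Complex a b))"
proof -
  have "norm (gabor f (c + (a, b))) = norm (cnj (gabor f (c + (a, b))))" by simp
  then show ?thesis unfolding cnj_gabor_eq_local_bargmann by (simp add: norm_mult)
qed

section \<open>A nonzero signal has a Gabor transform that vanishes on no disc\<close>

text \<open>The positive and negative parts of \<open>h\<close> have the same Fourier transform. At \<open>y = 0\<close> this says that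
they have the same mass \<open>c\<close>; divided by \<open>c\<close> they are densities of probability measures with the same
characteristic function, so Levy's uniqueness theorem applies.\<close>

lemma real_fourier_transform_injective:
  fixes h :: "real \<Rightarrow> real"
  assumes meas [measurable]: "h \<in> borel_measurable borel" and int: "integrable lborel h"
    and zero: "\<And>y. (LINT t|lborel. of_real (h t) * iexp (y * t)) = 0"
  shows "AE t in lborel. h t = 0"
proof -
  define p where "p t = max 0 (h t)" for t
  define n where "n t = max 0 (- h t)" for t
  define c where "c = integral\<^sup>L lborel p"
  have [measurable]: "p \<in> borel_measurable borel" "n \<in> borel_measurable borel"
    unfolding p_def n_def by measurable
  have p_int: "integrable lborel p" and n_int: "integrable lborel n"
    unfolding p_def n_def using int by auto
  have h: "h t = p t - n t" for t by (simp add: p_def n_def)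
  have p0: "0 \<le> p t" and n0: "0 \<le> n t" for t by (auto simp: p_def n_def)
  have int_exp: "integrable lborel (\<lambda>t. g t *\<^sub>R iexp (y * t))"
    if "integrable lborel g" and [measurable]: "g \<in> borel_measurable borel" for g :: "real \<Rightarrow> real" and y
    by (rule Bochner_Integration.integrable_bound[OF that(1)]) (auto simp: norm_exp_i_times)
  have eq_exp: "(LINT t|lborel. p t *\<^sub>R iexp (y * t)) = (LINT t|lborel. n t *\<^sub>R iexp (y * t))" for y
  proof -
    have "(LINT t|lborel. p t *\<^sub>R iexp (y * t)) - (LINT t|lborel. n t *\<^sub>R iexp (y * t))
        = (LINT t|lborel. p t *\<^sub>R iexp (y * t) - n t *\<^sub>R iexp (y * t))"
      by (intro Bochner_Integration.integral_diff[symmetric] int_exp p_int n_int) auto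
    also have "\<dots> = 0" using zero[of y] by (simp add: h scaleR_conv_of_real algebra_simps)
    finally show ?thesis by simp
  qed
  have cn: "c = integral\<^sup>L lborel n"
  proof -
    have "complex_of_real (integral\<^sup>L lborel p) = of_real (integral\<^sup>L lborel n)"
      using eq_exp[of 0] by (simp add: scaleR_conv_of_real)
    then show ?thesis by (simp add: c_def)
  qed
  show ?thesis
  proof (cases "c = 0")
    case True
    have "AE t in lborel. p t = 0" "AE t in lborel. n t = 0"
      using integral_nonneg_eq_0_iff_AE[OF p_int] integral_nonneg_eq_0_iff_AE[OF n_int] True p0 n0 cn
      by (auto simp: c_def)
    then show ?thesis by eventually_elim (simp add: h)
  next
    case False
    then have c0: "c > 0" using p0 by (simp add: c_def less_le integral_nonneg_AE)
    have distr: "real_distribution (density lborel (\<lambda>t. ennreal (g t / c)))"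
      and char: "char (density lborel (\<lambda>t. ennreal (g t / c))) y = (LINT t|lborel. g t *\<^sub>R iexp (y * t)) / c"
      if [measurable]: "g \<in> borel_measurable borel" and ig: "integrable lborel g" and g0: "\<And>t. 0 \<le> g t"
        and gc: "integral\<^sup>L lborel g = c" for g :: "real \<Rightarrow> real" and y
    proof -
      have "(\<integral>\<^sup>+t. ennreal (g t / c) \<partial>lborel) = ennreal (LINT t|lborel. g t / c)"
        using ig g0 c0 by (intro nn_integral_eq_integral) auto
      also have "\<dots> = 1" using gc c0 by simp
      finally have "emeasure (density lborel (\<lambda>t. ennreal (g t / c))) UNIV = 1"
        by (simp add: emeasure_density)
      then have "prob_space (density lborel (\<lambda>t. ennreal (g t / c)))"
        by (intro prob_spaceI) simp
      then show "real_distribution (density lborel (\<lambda>t. ennreal (g t / c)))"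
        by (simp add: real_distribution_def real_distribution_axioms_def)
      have "char (density lborel (\<lambda>t. ennreal (g t / c))) y = (LINT t|lborel. (g t / c) *\<^sub>R iexp (y * t))"
        unfolding char_def using g0 c0 by (intro integral_density) auto
      also have "\<dots> = (LINT t|lborel. (g t *\<^sub>R iexp (y * t)) / c)"
        by (simp add: scaleR_conv_of_real)
      finally show "char (density lborel (\<lambda>t. ennreal (g t / c))) y = (LINT t|lborel. g t *\<^sub>R iexp (y * t)) / c"
        by simp
    qed
    have "density lborel (\<lambda>t. ennreal (p t / c)) = density lborel (\<lambda>t. ennreal (n t / c))"
    proof (rule Levy_uniqueness)
      show "char (density lborel (\<lambda>t. ennreal (p t / c))) = char (density lborel (\<lambda>t. ennreal (n t / c)))"
        proof
        fix y
        show "char (density lborel (\<lambda>t. ennreal (p t / c))) y = char (density lborel (\<lambda>t. ennreal (n t / c))) y"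
          using char[OF _ p_int p0 c_def[symmetric]] char[OF _ n_int n0 cn[symmetric]] eq_exp[of y] by simp
      qed
      show "real_distribution (density lborel (\<lambda>t. ennreal (p t / c)))"
        by (rule distr[OF _ p_int p0 c_def[symmetric]]) measurable
      show "real_distribution (density lborel (\<lambda>t. ennreal (n t / c)))"
        by (rule distr[OF _ n_int n0 cn[symmetric]]) measurable
    qed
    then have "AE t in lborel. ennreal (p t / c) = ennreal (n t / c)"
      by (intro sigma_finite_measure.density_unique[OF lborel.sigma_finite_measure_axioms]) auto
    then show ?thesis
    proof eventually_elim
      case (elim t)
      then have "p t / c = n t / c" using p0[of t] n0[of t] c0 by simp
      then show ?case using c0 by (simp add: h)
    qed
  qed
qed

text \<open>The transform of \<open>cnj \<circ> k\<close> at \<open>y\<close> is the conjugate of the transform of \<open>k\<close> at \<open>- y\<close>; adding the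
two shows that the real part has vanishing transform. It agrees almost everywhere with a Borel
function, to which the real case applies.\<close>

lemma Re_eq_zero_of_fourier_transform_zero:
  fixes k :: "real \<Rightarrow> complex"
  assumes int: "integrable lebesgue k"
    and zero: "\<And>y. (LINT t|lebesgue. k t * iexp (y * t)) = 0"
  shows "AE t in lebesgue. Re (k t) = 0"
proof -
  have meas [measurable]: "k \<in> borel_measurable lebesgue" using int by auto
  have int_exp: "integrable lebesgue (\<lambda>t. g t * iexp (y * t))"
    if "integrable lebesgue g" for g :: "real \<Rightarrow> complex" and y
  proof -
    have [measurable]: "g \<in> borel_measurable lebesgue" using that by auto
    show ?thesis
      by (rule Bochner_Integration.integrable_bound[OF that]) (auto simp: norm_mult norm_exp_i_times)
  qed
  have icnj: "integrable lebesgue (\<lambda>t. cnj (k t))" using int by simp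
  have zero_cnj: "(LINT t|lebesgue. cnj (k t) * iexp (y * t)) = 0" for y
  proof -
    have "(LINT t|lebesgue. cnj (k t) * iexp (y * t)) = (LINT t|lebesgue. cnj (k t * iexp (- y * t)))"
      by (simp add: exp_cnj)
    also have "\<dots> = cnj (LINT t|lebesgue. k t * iexp (- y * t))"
      by (rule Bochner_Integration.integral_cnj)
    finally show ?thesis using zero[of "- y"] by simp
  qed
  have zero_Re: "(LINT t|lebesgue. of_real (Re (k t)) * iexp (y * t)) = 0" for y
  proof -
    have eq: "of_real (Re (k t)) * iexp (y * t) = (k t * iexp (y * t) + cnj (k t) * iexp (y * t)) / 2" for t
      by (simp add: complex_add_cnj flip: distrib_right)
    have "(LINT t|lebesgue. of_real (Re (k t)) * iexp (y * t))
        = (LINT t|lebesgue. k t * iexp (y * t) + cnj (k t) * iexp (y * t)) / 2"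
      unfolding eq by (rule integral_divide_zero)
    also have "\<dots> = 0"
      by (subst Bochner_Integration.integral_add[OF int_exp[OF int] int_exp[OF icnj]])
         (simp only: zero zero_cnj add_0_left div_0)
    finally show ?thesis .
  qed
  have "(\<lambda>t. Re (k t)) \<in> borel_measurable (completion lborel)" by measurable
  then obtain h where h [measurable]: "h \<in> borel_measurable lborel" and eq: "AE t in lborel. Re (k t) = h t"
    using completion_ex_borel_measurable_real by blast
  have eq': "AE t in lebesgue. Re (k t) = h t" using eq by (rule AE_completion)
  have "integrable lebesgue (\<lambda>t. Re (k t))" using int by simp
  then have "integrable lebesgue h"
    using eq' by (subst integrable_cong_AE[where g = "\<lambda>t. Re (k t)"]) (auto intro: measurable_completion)
  then have "integrable lborel h" by (simp add: integrable_completion)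
  moreover have "(LINT t|lborel. of_real (h t) * iexp (y * t)) = 0" for y
  proof -
    \<comment> \<open>With this rule the measurability prover would treat \<open>h\<close> as a map into the completed measure space.\<close>
    note [measurable del] = lebesgue_borel_ident_measurable
    have h_exp: "(\<lambda>t. complex_of_real (h t) * iexp (y * t)) \<in> borel_measurable lborel"
      using h unfolding measurable_lborel2 by measurable
    have "(LINT t|lborel. of_real (h t) * iexp (y * t)) = (LINT t|lebesgue. of_real (h t) * iexp (y * t))"
      by (rule integral_completion[OF h_exp, symmetric])
    also have "\<dots> = (LINT t|lebesgue. of_real (Re (k t)) * iexp (y * t))"
    proof (rule integral_cong_AE)
      show "(\<lambda>t. complex_of_real (h t) * iexp (y * t)) \<in> borel_measurable lebesgue"
        by (rule measurable_completion[OF h_exp])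
      show "AE t in lebesgue. complex_of_real (h t) * iexp (y * t) = of_real (Re (k t)) * iexp (y * t)"
        using eq' by eventually_elim simp
      have "continuous_on UNIV (\<lambda>t. iexp (y * t))" by (intro continuous_intros)
      then have "(\<lambda>t. iexp (y * t)) \<in> borel_measurable lebesgue"
        by (intro measurable_completion) (simp add: borel_measurable_continuous_onI)
      then show "(\<lambda>t. complex_of_real (Re (k t)) * iexp (y * t)) \<in> borel_measurable lebesgue"
        using meas by measurable
    qed
    finally show ?thesis using zero_Re by simp
  qed
  ultimately have "AE t in lborel. h t = 0"
    using h by (intro real_fourier_transform_injective) auto
  then have "AE t in lborel. Re (k t) = 0" using eq by eventually_elim simp
  then show ?thesis by (rule AE_completion)
qed

lemma fourier_transform_injective:
  fixes k :: "real \<Rightarrow> complex"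
  assumes int: "integrable lebesgue k"
    and zero: "\<And>y. (LINT t|lebesgue. k t * iexp (y * t)) = 0"
  shows "AE t in lebesgue. k t = 0"
proof -
  have "AE t in lebesgue. Re (k t) = 0"
    by (rule Re_eq_zero_of_fourier_transform_zero[OF assms])
  moreover have "AE t in lebesgue. Re (- \<i> * k t) = 0"
  proof (rule Re_eq_zero_of_fourier_transform_zero)
    show "integrable lebesgue (\<lambda>t. - \<i> * k t)" using int by simp
    have "(LINT t|lebesgue. - \<i> * k t * iexp (y * t)) = - \<i> * (LINT t|lebesgue. k t * iexp (y * t))" for y
      unfolding mult.assoc by (rule integral_mult_right_zero)
    then show "(LINT t|lebesgue. - \<i> * k t * iexp (y * t)) = 0" for y by (simp only: zero mult_zero_right)
  qed
  ultimately show ?thesis by eventually_elim (simp add: complex_eq_iff)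
qed

text \<open>On the imaginary axis the Bargmann transform is the Fourier transform of the integrable function
\<open>cnj (f t) * exp (- pi * t\<^sup>2)\<close>.\<close>

lemma bargmann_injective:
  assumes f: "square_integrable f" and zero: "\<And>\<zeta>. bargmann f \<zeta> = 0"
  shows "AE t in lebesgue. f t = 0"
proof -
  note [measurable] = square_integrable_measurable[OF f]
  define k where "k t = cnj (f t) * of_real (exp (- pi * t\<^sup>2))" for t
  have "AE t in lebesgue. k t = 0"
  proof (rule fourier_transform_injective)
    have [measurable]: "k \<in> borel_measurable lebesgue" unfolding k_def by measurable
    show "integrable lebesgue k"
      using integrable_gaussian_exponential_weight[OF f, of 0]
      by (rule Bochner_Integration.integrable_bound) (auto simp: k_def norm_mult)
    show "(LINT t|lebesgue. k t * iexp (y * t)) = 0" for y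
    proof -
      have "2 * of_real pi * (\<i> * of_real (y / (2 * pi))) * of_real t = \<i> * complex_of_real (y * t)" for t
        by simp
      then show ?thesis
        using zero[of "\<i> * of_real (y / (2 * pi))"] by (simp only: bargmann_def k_def)
    qed
  qed
  then show ?thesis by eventually_elim (simp add: k_def)
qed

text \<open>Otherwise the entire function \<open>bargmann f\<close> would vanish on a disc and hence everywhere.\<close>

lemma gabor_nonzero_near_every_point:
  assumes f: "square_integrable f" and nz: "\<not> (AE t in lebesgue. f t = 0)" and r: "r > 0"
  shows "\<exists>z\<in>ball c r. gabor f z \<noteq> 0"
proof (rule ccontr)
  assume contr: "\<not> ?thesis"
  obtain p q where c: "c = (p, q)" by (cases c)
  have zero: "bargmann f \<zeta> = 0" if "\<zeta> \<in> ball (Complex p q) r" for \<zeta>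
  proof -
    obtain x y where \<zeta>: "\<zeta> = Complex x y" by (cases \<zeta>)
    have "dist c (x, y) = dist (Complex p q) \<zeta>"
      by (simp add: c \<zeta> dist_norm norm_Pair cmod_def)
    then have "gabor f (x, y) = 0" using that contr by auto
    then show ?thesis using cnj_gabor_eq_bargmann[of f x y] by (simp add: \<zeta>)
  qed
  have "bargmann f \<zeta> = 0" for \<zeta>
  proof (rule analytic_continuation_open[where f = "bargmann f" and g = "\<lambda>_. 0"])
    show "ball (Complex p q) r \<noteq> {}" using r by simp
    show "bargmann f holomorphic_on UNIV" by (rule bargmann_holomorphic[OF f])
    show "bargmann f w = 0" if "w \<in> ball (Complex p q) r" for w by (rule zero[OF that])
  qed auto
  then show False using bargmann_injective[OF f] nz by blast
qed

section \<open>Distance up to a phase and rank one kernels\<close>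

lemma Lp_norm_2: "Lp_norm 2 M F = sqrt (LINT z|M. (norm (F z))\<^sup>2)"
  by (simp add: Lp_norm_def powr_half_sqrt)

lemma Lp_norm_1: "Lp_norm 1 M F = (LINT z|M. norm (F z))"
  by (simp add: Lp_norm_def)

lemma norm_diff_square_complex:
  fixes p q :: complex
  shows "(norm (p - q))\<^sup>2 = (norm p)\<^sup>2 + (norm q)\<^sup>2 - 2 * Re (p * cnj q)"
  by (simp only: cmod_power2) (simp add: power2_eq_square algebra_simps)

lemma integral_quadratic_combination:
  fixes p q r :: "'a \<Rightarrow> real"
  assumes "integrable M p" "integrable M q" "integrable M r"
  shows "integrable M (\<lambda>z. s * p z + t * q z - 2 * r z)"
    and "(LINT z|M. s * p z + t * q z - 2 * r z)
           = s * integral\<^sup>L M p + t * integral\<^sup>L M q - 2 * integral\<^sup>L M r"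
  using assms by auto

text \<open>The left side is the integral of \<open>|u z * cnj (u z') - v z * cnj (v z')|\<^sup>2\<close> over both variables. It
is computed by integrating the expanded square in \<open>z'\<close> and then in \<open>z\<close>, so that only linearity of
the integral enters.\<close>

lemma rank_one_difference_integral_bound:
  fixes u v :: "'a \<Rightarrow> complex"
  assumes fin: "finite_measure M" and m: "measure M (space M) \<le> m"
    and u: "integrable M (\<lambda>z. (norm (u z))\<^sup>2)" and v: "integrable M (\<lambda>z. (norm (v z))\<^sup>2)"
    and uv: "integrable M (\<lambda>z. u z * cnj (v z))"
    and K: "\<And>z z'. z \<in> space M \<Longrightarrow> z' \<in> space M \<Longrightarrow>
              (norm (u z * cnj (u z') - v z * cnj (v z')))\<^sup>2 \<le> K" "K \<ge> 0"
  shows "(LINT z|M. (norm (u z))\<^sup>2)\<^sup>2 + (LINT z|M. (norm (v z))\<^sup>2)\<^sup>2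
           - 2 * (norm (LINT z|M. u z * cnj (v z)))\<^sup>2 \<le> m\<^sup>2 * K"
proof -
  interpret finite_measure M by (rule fin)
  define a b \<gamma> where "a = (LINT z|M. (norm (u z))\<^sup>2)" and "b = (LINT z|M. (norm (v z))\<^sup>2)"
    and "\<gamma> = (LINT z|M. u z * cnj (v z))"
  have m0: "m \<ge> 0" using m measure_nonneg[of M "space M"] by linarith
  have const: "(LINT z|M. k) \<le> m * k" if "k \<ge> 0" for k :: real
    using m that by (simp add: mult_right_mono)
  have half: "a * (norm (u z))\<^sup>2 + b * (norm (v z))\<^sup>2 - 2 * Re (u z * cnj (v z) * cnj \<gamma>) \<le> m * K"
    if z: "z \<in> space M" for z
  proof -
    have exp: "(norm (u z * cnj (u z') - v z * cnj (v z')))\<^sup>2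
        = (norm (u z))\<^sup>2 * (norm (u z'))\<^sup>2 + (norm (v z))\<^sup>2 * (norm (v z'))\<^sup>2
          - 2 * Re (u z * cnj (v z) * cnj (u z' * cnj (v z')))" for z'
      unfolding norm_diff_square_complex by (simp add: norm_mult power_mult_distrib mult_ac)
    have i: "integrable M (\<lambda>z'. u z * cnj (v z) * cnj (u z' * cnj (v z')))"
      by (intro integrable_mult_right) (use uv in \<open>simp only: integrable_cnj\<close>)
    note comb = integral_quadratic_combination[OF u v integrable_Re[OF i],
        of "(norm (u z))\<^sup>2" "(norm (v z))\<^sup>2"]
    have "Re (u z * cnj (v z) * cnj \<gamma>) = Re (LINT z'|M. u z * cnj (v z) * cnj (u z' * cnj (v z')))"
      by (simp only: integral_mult_right_zero Bochner_Integration.integral_cnj \<gamma>_def)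
    also have "\<dots> = (LINT z'|M. Re (u z * cnj (v z) * cnj (u z' * cnj (v z'))))"
      by (rule integral_Re[OF i, symmetric])
    finally have "a * (norm (u z))\<^sup>2 + b * (norm (v z))\<^sup>2 - 2 * Re (u z * cnj (v z) * cnj \<gamma>)
        = (LINT z'|M. (norm (u z))\<^sup>2 * (norm (u z'))\<^sup>2 + (norm (v z))\<^sup>2 * (norm (v z'))\<^sup>2
          - 2 * Re (u z * cnj (v z) * cnj (u z' * cnj (v z'))))"
      unfolding comb(2) a_def b_def by (simp only: mult.commute)
    also have "\<dots> \<le> (LINT z'|M. K)"
    proof (rule integral_mono[OF comb(1)])
      show "(norm (u z))\<^sup>2 * (norm (u z'))\<^sup>2 + (norm (v z))\<^sup>2 * (norm (v z'))\<^sup>2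
          - 2 * Re (u z * cnj (v z) * cnj (u z' * cnj (v z'))) \<le> K" if "z' \<in> space M" for z'
        using K(1)[OF z that] unfolding exp .
    qed simp
    also have "\<dots> \<le> m * K" by (rule const[OF K(2)])
    finally show ?thesis .
  qed
  have i: "integrable M (\<lambda>z. u z * cnj (v z) * cnj \<gamma>)"
    by (intro integrable_mult_left uv)
  note comb = integral_quadratic_combination[OF u v integrable_Re[OF i], of a b]
  have "(norm \<gamma>)\<^sup>2 = Re (\<gamma> * cnj \<gamma>)" by (simp only: complex_norm_square[symmetric] Re_complex_of_real)
  also have "\<gamma> * cnj \<gamma> = (LINT z|M. u z * cnj (v z) * cnj \<gamma>)"
    by (simp only: integral_mult_left_zero \<gamma>_def)
  also have "Re \<dots> = (LINT z|M. Re (u z * cnj (v z) * cnj \<gamma>))"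
    by (rule integral_Re[OF i, symmetric])
  finally have "a\<^sup>2 + b\<^sup>2 - 2 * (norm \<gamma>)\<^sup>2
      = (LINT z|M. a * (norm (u z))\<^sup>2 + b * (norm (v z))\<^sup>2 - 2 * Re (u z * cnj (v z) * cnj \<gamma>))"
    unfolding comb(2) unfolding a_def b_def by (simp only: power2_eq_square)
  also have "\<dots> \<le> (LINT z|M. m * K)"
    by (rule integral_mono[OF comb(1)]) (use half in auto)
  also have "\<dots> \<le> m * (m * K)" using m0 K(2) by (intro const) auto
  finally show ?thesis by (simp add: a_def b_def \<gamma>_def power2_eq_square mult.assoc)
qed

text \<open>The squared distance is \<open>a + b - 2 * Re (\<sigma> * \<gamma>)\<close> with \<open>\<gamma>\<close> the inner product, and \<open>\<tau>\<close> rotates \<open>\<gamma>\<close>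
to the positive real axis.\<close>

lemma best_unimodular_multiple:
  fixes u v :: "'a \<Rightarrow> complex"
  assumes u: "integrable M (\<lambda>z. (norm (u z))\<^sup>2)" and v: "integrable M (\<lambda>z. (norm (v z))\<^sup>2)"
    and uv: "integrable M (\<lambda>z. u z * cnj (v z))"
  obtains \<tau> where
    "is_arg_min (\<lambda>\<sigma>. Lp_norm 2 M (\<lambda>z. v z - \<sigma> * u z)) (\<lambda>\<sigma>. \<sigma> \<in> sphere 0 1) \<tau>"
    "(Lp_norm 2 M (\<lambda>z. v z - \<tau> * u z))\<^sup>2 = (LINT z|M. (norm (u z))\<^sup>2)
       + (LINT z|M. (norm (v z))\<^sup>2) - 2 * norm (LINT z|M. u z * cnj (v z))"
proof -
  define a b \<gamma> where "a = (LINT z|M. (norm (u z))\<^sup>2)" and "b = (LINT z|M. (norm (v z))\<^sup>2)"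
    and "\<gamma> = (LINT z|M. u z * cnj (v z))"
  have val: "(LINT z|M. (norm (v z - \<sigma> * u z))\<^sup>2) = a + b - 2 * Re (\<sigma> * \<gamma>)" if "norm \<sigma> = 1" for \<sigma>
  proof -
    have i: "integrable M (\<lambda>z. \<sigma> * (u z * cnj (v z)))" by (intro integrable_mult_right uv)
    note comb = integral_quadratic_combination[OF u v integrable_Re[OF i], of 1 1, unfolded mult_1]
    have eq: "(norm (v z - \<sigma> * u z))\<^sup>2 = (norm (u z))\<^sup>2 + (norm (v z))\<^sup>2 - 2 * Re (\<sigma> * (u z * cnj (v z)))" for z
      using that unfolding norm_minus_commute[of "v z"] norm_diff_square_complex
      by (simp add: norm_mult mult.assoc)
    have "Re (\<sigma> * \<gamma>) = (LINT z|M. Re (\<sigma> * (u z * cnj (v z))))"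
      unfolding integral_Re[OF i] by (simp only: integral_mult_right_zero \<gamma>_def)
    then show ?thesis unfolding eq comb(2) a_def b_def by (simp only:)
  qed
  define \<tau> where "\<tau> = (if \<gamma> = 0 then 1 else cnj \<gamma> / norm \<gamma>)"
  have \<tau>1: "norm \<tau> = 1" by (simp add: \<tau>_def norm_divide)
  have \<tau>\<gamma>: "Re (\<tau> * \<gamma>) = norm \<gamma>"
  proof (cases "\<gamma> = 0")
    case False
    have "cnj \<gamma> * \<gamma> = of_real ((norm \<gamma>)\<^sup>2)" by (metis complex_norm_square mult.commute)
    then have "\<tau> * \<gamma> = of_real ((norm \<gamma>)\<^sup>2 / norm \<gamma>)" using False by (simp add: \<tau>_def)
    then show ?thesis using False by (simp add: power2_eq_square)
  qed (simp add: \<tau>_def)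
  have le: "Re (\<sigma> * \<gamma>) \<le> norm \<gamma>" if "norm \<sigma> = 1" for \<sigma>
    using complex_Re_le_cmod[of "\<sigma> * \<gamma>"] that by (simp add: norm_mult)
  show ?thesis
  proof (rule that)
    show "is_arg_min (\<lambda>\<sigma>. Lp_norm 2 M (\<lambda>z. v z - \<sigma> * u z)) (\<lambda>\<sigma>. \<sigma> \<in> sphere 0 1) \<tau>"
    proof -
      have "Lp_norm 2 M (\<lambda>z. v z - \<tau> * u z) \<le> Lp_norm 2 M (\<lambda>z. v z - \<sigma> * u z)" if "norm \<sigma> = 1" for \<sigma>
        unfolding Lp_norm_2 val[OF that] val[OF \<tau>1] \<tau>\<gamma>
        using le[OF that] by (intro real_sqrt_le_mono) linarith
      then show ?thesis using \<tau>1 by (auto simp: is_arg_min_linorder)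
    qed
    have "0 \<le> (LINT z|M. (norm (v z - \<tau> * u z))\<^sup>2)" by simp
    then show "(Lp_norm 2 M (\<lambda>z. v z - \<tau> * u z))\<^sup>2 = (LINT z|M. (norm (u z))\<^sup>2)
       + (LINT z|M. (norm (v z))\<^sup>2) - 2 * norm (LINT z|M. u z * cnj (v z))"
      unfolding Lp_norm_2 using val[OF \<tau>1] \<tau>\<gamma> by (simp add: a_def b_def \<gamma>_def)
  qed
qed

section \<open>Geometry of the square and integrals over it\<close>

text \<open>In the plane an orthonormal pair is a rotation or a reflection: \<open>v = (- d * u2, d * u1)\<close> with the
determinant \<open>d\<close> of square one. The two coordinates of the claim are then polynomial identities.\<close>

lemma orthonormal_expansion_plane:
  fixes u v w :: "real \<times> real"
  assumes "norm u = 1" "norm v = 1" "u \<bullet> v = 0"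
  shows "w = (w \<bullet> u) *\<^sub>R u + (w \<bullet> v) *\<^sub>R v"
proof -
  obtain u1 u2 v1 v2 w1 w2 where e: "u = (u1, u2)" "v = (v1, v2)" "w = (w1, w2)"
    by (metis prod.collapse)
  have uu: "u1\<^sup>2 + u2\<^sup>2 = 1" and vv: "v1\<^sup>2 + v2\<^sup>2 = 1" and uv: "u1 * v1 + u2 * v2 = 0"
    using assms by (auto simp: e norm_Pair inner_Pair)
  define d where "d = u1 * v2 - u2 * v1"
  have v1: "v1 = - d * u2" and v2: "v2 = d * u1"
    using uu uv unfolding d_def by algebra+
  have d: "d\<^sup>2 = 1" using vv uu unfolding v1 v2 by algebra
  have "w1 = (w1 * u1 + w2 * u2) * u1 + (w1 * v1 + w2 * v2) * v1"
    using uu d unfolding v1 v2 by algebra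
  moreover have "w2 = (w1 * u1 + w2 * u2) * u2 + (w1 * v1 + w2 * v2) * v2"
    using uu d unfolding v1 v2 by algebra
  ultimately show ?thesis by (simp add: e inner_Pair)
qed

text \<open>Comparison with two discs removes the orientation of the square: the data are used on a small
axis-parallel box inside the inner disc, the estimate is needed on the outer disc.\<close>

lemma unit_square_geometry:
  assumes "is_square 1 Q"
  obtains c where "compact Q" "cball c (1/2) \<subseteq> Q" "Q \<subseteq> cball c 1"
proof -
  obtain c u v where uv: "norm u = 1" "norm v = 1" "u \<bullet> v = 0"
    and Q: "Q = {c + s *\<^sub>R u + t *\<^sub>R v | s t. \<bar>s\<bar> \<le> 1 / 2 \<and> \<bar>t\<bar> \<le> 1 / 2}"
    using assms unfolding is_square_def by auto
  show ?thesis
  proof (rule that)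
    have "Q = (\<lambda>p. c + fst p *\<^sub>R u + snd p *\<^sub>R v) ` cbox (-1/2, -1/2) (1/2, 1/2)"
      unfolding Q by (force simp: cbox_Pair_eq abs_le_iff image_iff)
    then show "compact Q"
      by (simp only:) (intro compact_continuous_image continuous_intros compact_cbox)
    show "cball c (1/2) \<subseteq> Q"
    proof
      fix z assume "z \<in> cball c (1/2)"
      then have n: "norm (z - c) \<le> 1 / 2" by (simp add: dist_norm norm_minus_commute)
      have "z = c + ((z - c) \<bullet> u) *\<^sub>R u + ((z - c) \<bullet> v) *\<^sub>R v"
        using orthonormal_expansion_plane[OF uv, of "z - c"] by (simp add: algebra_simps)
      moreover have "\<bar>(z - c) \<bullet> u\<bar> \<le> 1 / 2" "\<bar>(z - c) \<bullet> v\<bar> \<le> 1 / 2"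
        using Cauchy_Schwarz_ineq2[of "z - c" u] Cauchy_Schwarz_ineq2[of "z - c" v] uv n by auto
      ultimately show "z \<in> Q" unfolding Q by blast
    qed
    show "Q \<subseteq> cball c 1"
    proof
      fix z assume "z \<in> Q"
      then obtain s t where st: "z = c + s *\<^sub>R u + t *\<^sub>R v" "\<bar>s\<bar> \<le> 1 / 2" "\<bar>t\<bar> \<le> 1 / 2"
        unfolding Q by blast
      have "z - c = s *\<^sub>R u + t *\<^sub>R v" by (simp add: st(1))
      then have "dist c z = norm (s *\<^sub>R u + t *\<^sub>R v)" by (metis dist_commute dist_norm)
      also have "\<dots> \<le> 1" using norm_triangle_ineq[of "s *\<^sub>R u" "t *\<^sub>R v"] st uv by simp
      finally show "z \<in> cball c 1" by simp
    qed
  qed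
qed

lemma continuous_integrable_on_compact:
  fixes f :: "'a::euclidean_space \<Rightarrow> 'b::euclidean_space"
  assumes "compact S" "continuous_on S f"
  shows "integrable (lebesgue_on S) f"
proof -
  have "integrable lborel (\<lambda>x. indicator S x *\<^sub>R f x)" using assms by (rule borel_integrable_compact)
  then have "integrable lebesgue (\<lambda>x. indicator S x *\<^sub>R f x)"
    by (subst integrable_completion) auto
  then show ?thesis
    using assms(1) by (subst integrable_restrict_space) (auto simp: compact_imp_closed)
qed

text \<open>The Cauchy-Schwarz inequality against the constant one, from the nonnegative integral of
\<open>(|h| - I / 4)\<^sup>2\<close>.\<close>

lemma integral_abs_le_Lp_norm_2:
  fixes h :: "'a \<Rightarrow> real"
  assumes fin: "finite_measure M" and m: "measure M (space M) \<le> 4"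
    and h: "integrable M h" and h2: "integrable M (\<lambda>z. (h z)\<^sup>2)"
  shows "(LINT z|M. \<bar>h z\<bar>) \<le> 2 * Lp_norm 2 M h"
proof -
  interpret finite_measure M by (rule fin)
  define I where "I = (LINT z|M. \<bar>h z\<bar>)"
  have "0 \<le> (LINT z|M. (\<bar>h z\<bar> - I / 4)\<^sup>2)" by simp
  also have "\<dots> = (LINT z|M. (h z)\<^sup>2 - I / 2 * \<bar>h z\<bar> + I\<^sup>2 / 16)"
    by (intro Bochner_Integration.integral_cong refl) (simp add: power2_diff power_divide)
  also have "\<dots> = (LINT z|M. (h z)\<^sup>2) - I / 2 * I + I\<^sup>2 / 16 * measure M (space M)"
    using h h2 by (simp add: I_def)
  also have "\<dots> \<le> (LINT z|M. (h z)\<^sup>2) - I / 2 * I + I\<^sup>2 / 16 * 4"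
    using m by (intro add_left_mono mult_left_mono) auto
  finally have "(I / 2)\<^sup>2 \<le> (LINT z|M. (h z)\<^sup>2)" by (simp add: power2_eq_square)
  then have "I / 2 \<le> sqrt (LINT z|M. (h z)\<^sup>2)" by (rule real_le_rsqrt)
  then show ?thesis by (simp add: I_def Lp_norm_2)
qed

section \<open>Transfer from entire functions to Gabor transforms\<close>

lemma local_bargmann_square:
  "(norm (local_bargmann f c (Complex x y)))\<^sup>2 = exp (2 * pi * x\<^sup>2) * spectrogram f (c + (x, y))"
proof -
  have "exp (2 * pi * x\<^sup>2) * (exp (- pi * x\<^sup>2))\<^sup>2 = 1"
    by (simp flip: exp_double exp_add)
  then show ?thesis
    unfolding spectrogram_def norm_gabor_eq_local_bargmann power_mult_distrib
    by (simp flip: mult.assoc)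
qed

lemma local_bargmann_norm_le:
  assumes f: "square_integrable f" and z: "norm z \<le> R"
  shows "norm (local_bargmann f c z) \<le> exp (pi * R\<^sup>2) * sqrt (Linf_norm lebesgue (spectrogram f))"
proof -
  obtain x y where xy: "z = Complex x y" by (cases z)
  have "x\<^sup>2 \<le> R\<^sup>2"
  proof -
    have "\<bar>x\<bar> \<le> R" using abs_Re_le_cmod[of z] z by (simp add: xy)
    then show ?thesis by (metis abs_ge_zero power2_abs power_mono)
  qed
  then have "exp (2 * pi * x\<^sup>2) \<le> exp (2 * pi * R\<^sup>2)" by simp
  also have "\<dots> = (exp (pi * R\<^sup>2))\<^sup>2" by (simp flip: exp_double add: mult.assoc)
  finally have "(norm (local_bargmann f c z))\<^sup>2 \<le> (exp (pi * R\<^sup>2))\<^sup>2 * Linf_norm lebesgue (spectrogram f)"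
    unfolding xy local_bargmann_square
    using spectrogram_le_Linf_norm[OF f] by (intro mult_mono) (auto simp: spectrogram_def)
  then have "norm (local_bargmann f c z) \<le> sqrt ((exp (pi * R\<^sup>2))\<^sup>2 * Linf_norm lebesgue (spectrogram f))"
    by (rule real_le_rsqrt)
  then show ?thesis by (simp add: real_sqrt_mult)
qed

lemma gabor_difference_le_local_bargmann:
  fixes f g :: "real \<Rightarrow> complex" and a b p q :: real and c :: "real \<times> real"
  defines "F \<equiv> local_bargmann f c" and "G \<equiv> local_bargmann g c"
  shows "norm (gabor f (c + (a, b)) * cnj (gabor f (c + (p, q)))
             - gabor g (c + (a, b)) * cnj (gabor g (c + (p, q))))
       \<le> norm (F (Complex a b) * cnj (F (Complex p q)) - G (Complex a b) * cnj (G (Complex p q)))"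
proof -
  define \<mu> where "\<mu> x y = of_real (exp (- pi * x\<^sup>2)) * cis (2 * pi * fst c * y)" for x y
  have rep: "cnj (gabor h (c + (x, y))) = \<mu> x y * local_bargmann h c (Complex x y)" for h x y
    unfolding \<mu>_def by (rule cnj_gabor_eq_local_bargmann)
  have \<mu>1: "norm (\<mu> x y) \<le> 1" for x y by (simp add: \<mu>_def norm_mult)
  have "gabor f (c + (a, b)) * cnj (gabor f (c + (p, q))) - gabor g (c + (a, b)) * cnj (gabor g (c + (p, q)))
      = cnj (cnj (gabor f (c + (a, b))) * cnj (cnj (gabor f (c + (p, q))))
          - cnj (gabor g (c + (a, b))) * cnj (cnj (gabor g (c + (p, q)))))"
    by (simp only: complex_cnj_diff complex_cnj_mult complex_cnj_cnj)
  also have "norm \<dots> = norm (\<mu> a b * cnj (\<mu> p q)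
      * (F (Complex a b) * cnj (F (Complex p q)) - G (Complex a b) * cnj (G (Complex p q))))"
    unfolding rep F_def G_def complex_mod_cnj by (simp add: algebra_simps)
  also have "\<dots> \<le> 1 * 1 * norm (F (Complex a b) * cnj (F (Complex p q)) - G (Complex a b) * cnj (G (Complex p q)))"
    unfolding norm_mult complex_mod_cnj using \<mu>1 by (intro mult_right_mono mult_mono) auto
  finally show ?thesis by simp
qed

text \<open>The two \<open>L\<^sup>\<infinity>\<close> norms bound the local Bargmann transforms on the disc of radius \<open>R\<close> up to the
factor \<open>exp (pi * R\<^sup>2)\<close>, and on the box the Gaussian weight between \<open>|F|\<^sup>2 - |G|\<^sup>2\<close> and the difference of the
spectrograms is at most \<open>exp (2 * pi)\<close>. Both factors are independent of the centre.\<close>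

lemma gabor_rank_one_difference_bound:
  obtains C where "C > 0"
    "\<And>f g c z z'. square_integrable f \<Longrightarrow> square_integrable g \<Longrightarrow> z \<in> cball c 1 \<Longrightarrow> z' \<in> cball c 1 \<Longrightarrow>
       (norm (gabor f z * cnj (gabor f z') - gabor g z * cnj (gabor g z')))\<^sup>2
       \<le> C * (Linf_norm lebesgue (spectrogram f) + Linf_norm lebesgue (spectrogram g))
           * integral (cbox c (c + (1/4, 1/4))) (\<lambda>z. \<bar>spectrogram f z - spectrogram g z\<bar>)"
proof -
  define R :: real where "R = 2 * 1536 ^ 4"
  define C1 :: real where "C1 = (2 * 1536\<^sup>2 * (1 + 1536\<^sup>2))\<^sup>2"
  define C where "C = C1 * (exp (pi * R\<^sup>2))\<^sup>2 * exp (2 * pi)"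
  have "C > 0" by (simp add: C_def C1_def)
  moreover have "(norm (gabor f z * cnj (gabor f z') - gabor g z * cnj (gabor g z')))\<^sup>2
       \<le> C * (Linf_norm lebesgue (spectrogram f) + Linf_norm lebesgue (spectrogram g))
           * integral (cbox c (c + (1/4, 1/4))) (\<lambda>z. \<bar>spectrogram f z - spectrogram g z\<bar>)"
    if f: "square_integrable f" and g: "square_integrable g"
      and z: "z \<in> cball c 1" and z': "z' \<in> cball c 1" for f g c z z'
  proof -
    define F G where "F = local_bargmann f c" and "G = local_bargmann g c"
    define Lf Lg where "Lf = Linf_norm lebesgue (spectrogram f)" and "Lg = Linf_norm lebesgue (spectrogram g)"
    define D where "D z = \<bar>spectrogram f z - spectrogram g z\<bar>" for z
    have L0: "0 \<le> Lf" "0 \<le> Lg"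
      using spectrogram_le_Linf_norm[OF f, of c] spectrogram_le_Linf_norm[OF g, of c]
      unfolding Lf_def Lg_def by (auto intro: order_trans[rotated] simp: spectrogram_def)
    define K where "K = (exp (pi * R\<^sup>2))\<^sup>2 * (Lf + Lg)"
    define E where "E = integral (cbox (0, 0) (1/4, 1/4))
                  (\<lambda>(x, y). \<bar>(norm (F (Complex x y)))\<^sup>2 - (norm (G (Complex x y)))\<^sup>2\<bar>)"
    have K: "norm (F s) * norm (F t) + norm (G s) * norm (G t) \<le> K"
      if st: "norm s \<le> 2 * 1536 ^ 4" "norm t \<le> 2 * 1536 ^ 4" for s t
    proof -
      have prod: "norm (local_bargmann h c s) * norm (local_bargmann h c t)
          \<le> (exp (pi * R\<^sup>2))\<^sup>2 * Linf_norm lebesgue (spectrogram h)"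
        if h: "square_integrable h" and h0: "0 \<le> Linf_norm lebesgue (spectrogram h)" for h
      proof -
        have "norm (local_bargmann h c s) * norm (local_bargmann h c t)
            \<le> (exp (pi * R\<^sup>2) * sqrt (Linf_norm lebesgue (spectrogram h)))
              * (exp (pi * R\<^sup>2) * sqrt (Linf_norm lebesgue (spectrogram h)))"
          using st h0 unfolding R_def[symmetric]
          by (intro mult_mono local_bargmann_norm_le[OF h]) auto
        also have "\<dots> = (exp (pi * R\<^sup>2))\<^sup>2 * (sqrt (Linf_norm lebesgue (spectrogram h)))\<^sup>2"
          by (simp only: power2_eq_square mult_ac)
        finally show ?thesis using h0 by simp
      qed
      show ?thesis
        using add_mono[OF prod[OF f] prod[OF g]] L0 by (simp add: F_def G_def K_def Lf_def Lg_def distrib_left)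
    qed
    obtain a b where ab: "z = c + (a, b)" by (metis add_diff_cancel_left' diff_add_cancel add.commute prod.collapse)
    obtain p q where pq: "z' = c + (p, q)" by (metis add_diff_cancel_left' diff_add_cancel add.commute prod.collapse)
    have ab1: "norm (Complex a b) \<le> 1" using z by (simp add: ab dist_norm norm_Pair cmod_def)
    have pq1: "norm (Complex p q) \<le> 1" using z' by (simp add: pq dist_norm norm_Pair cmod_def)
    have contD: "continuous_on S D" for S
      unfolding D_def by (intro continuous_intros continuous_on_spectrogram f g)
    have E_le: "E \<le> exp (2 * pi) * integral (cbox c (c + (1/4, 1/4))) D"
    proof -
      have "E = integral (cbox (0, 0) (1/4, 1/4)) (\<lambda>p. exp (2 * pi * (fst p)\<^sup>2) * D (p + c))"
      proof -
        have "\<bar>(norm (F (Complex x y)))\<^sup>2 - (norm (G (Complex x y)))\<^sup>2\<bar> = exp (2 * pi * x\<^sup>2) * D ((x, y) + c)" for x y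
          unfolding F_def G_def local_bargmann_square D_def right_diff_distrib[symmetric] abs_mult
          by (simp add: add.commute)
        then show ?thesis by (simp add: E_def case_prod_unfold)
      qed
      also have "\<dots> \<le> integral (cbox (0, 0) (1/4, 1/4)) (\<lambda>p. exp (2 * pi) * D (p + c))"
      proof (intro integral_le integrable_continuous)
        fix p :: "real \<times> real" assume "p \<in> cbox (0, 0) (1/4, 1/4)"
        then have "\<bar>fst p\<bar> \<le> 1" by (cases p) (auto simp: cbox_Pair_eq)
        then have "(fst p)\<^sup>2 \<le> 1" by (simp add: abs_square_le_1)
        then have "exp (2 * pi * (fst p)\<^sup>2) \<le> exp (2 * pi)" by simp
        then show "exp (2 * pi * (fst p)\<^sup>2) * D (p + c) \<le> exp (2 * pi) * D (p + c)"
          by (rule mult_right_mono) (simp add: D_def)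
      qed (intro continuous_intros continuous_on_compose2[OF contD]; auto)+
      also have "\<dots> = exp (2 * pi) * integral (cbox (0, 0) (1/4, 1/4)) (\<lambda>p. D (p + c))"
        by (rule integral_mult_right)
      also have "integral (cbox (0, 0) (1/4, 1/4)) (\<lambda>p. D (p + c)) = integral (cbox c (c + (1/4, 1/4))) D"
        using integral_shift_cbox[of c c "c + (1/4, 1/4)" D] by (simp add: zero_prod_def)
      finally show ?thesis .
    qed
    have "(norm (gabor f z * cnj (gabor f z') - gabor g z * cnj (gabor g z')))\<^sup>2
        \<le> (norm (F (Complex a b) * cnj (F (Complex p q)) - G (Complex a b) * cnj (G (Complex p q))))\<^sup>2"
      unfolding ab pq F_def G_def by (intro power_mono gabor_difference_le_local_bargmann norm_ge_zero)
    also have "\<dots> \<le> C1 * (K * E)"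
      unfolding C1_def E_def
      by (rule polarized_difference_bound[OF _ _ K ab1 pq1])
         (auto simp: F_def G_def intro: local_bargmann_holomorphic f g)
    also have "\<dots> \<le> C1 * (K * (exp (2 * pi) * integral (cbox c (c + (1/4, 1/4))) D))"
      using E_le L0 by (intro mult_left_mono) (auto simp: C1_def K_def)
    finally show ?thesis
      by (simp add: C_def K_def Lf_def Lg_def D_def[abs_def] mult_ac)
  qed
  ultimately show ?thesis using that by blast
qed

section \<open>Stability of phase retrieval on the square\<close>

lemma integral_spectrogram_pos:
  assumes f: "square_integrable f" and nz: "\<not> (AE t in lebesgue. f t = 0)"
    and Q: "compact Q" "cball c r \<subseteq> Q" and r: "r > 0"
  shows "0 < (LINT z|lebesgue_on Q. spectrogram f z)"
proof -
  have int: "integrable (lebesgue_on Q) (spectrogram f)"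
    by (intro continuous_integrable_on_compact Q(1) continuous_on_spectrogram[OF f])
  have s0: "0 \<le> spectrogram f z" for z by (simp add: spectrogram_def)
  obtain z where z: "z \<in> ball c r" "gabor f z \<noteq> 0"
    using gabor_nonzero_near_every_point[OF f nz r] by blast
  have "(LINT z|lebesgue_on Q. spectrogram f z) \<noteq> 0"
  proof
    assume "(LINT z|lebesgue_on Q. spectrogram f z) = 0"
    then have "AE z in lebesgue_on Q. spectrogram f z = 0"
      using integral_nonneg_eq_0_iff_AE[OF int] s0 by auto
    then have "AE z in lebesgue. z \<in> Q \<longrightarrow> spectrogram f z = 0"
      using Q(1) by (subst (asm) AE_restrict_space_iff) (auto simp: compact_imp_closed)
    then obtain N where N: "\<And>z. z \<in> space lebesgue - N \<Longrightarrow> z \<in> Q \<longrightarrow> spectrogram f z = 0"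
      "N \<in> null_sets lebesgue"
      by (elim AE_E3) blast
    have sub: "ball c r \<inter> {z. 0 < spectrogram f z} \<subseteq> N"
    proof
      fix w assume w: "w \<in> ball c r \<inter> {z. 0 < spectrogram f z}"
      then have "w \<in> Q" using Q(2) by auto
      then show "w \<in> N" using N(1)[of w] w by auto
    qed
    have "negligible (ball c r \<inter> {z. 0 < spectrogram f z})"
      using negligible_subset[OF _ sub] N(2) by (simp add: negligible_iff_null_sets)
    moreover have "open (ball c r \<inter> {z. 0 < spectrogram f z})"
      by (intro open_Int open_ball open_Collect_less continuous_intros continuous_on_spectrogram[OF f])
    ultimately have "ball c r \<inter> {z. 0 < spectrogram f z} = {}"
      using open_not_negligible by blast
    moreover have "z \<in> ball c r \<inter> {z. 0 < spectrogram f z}" using z by (simp add: spectrogram_def)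
    ultimately show False by blast
  qed
  moreover have "0 \<le> (LINT z|lebesgue_on Q. spectrogram f z)" using s0 by (simp add: integral_nonneg_AE)
  ultimately show ?thesis by simp
qed

text \<open>Multiplying by \<open>a + b + 2 * s\<close> instead of \<open>a\<close> gives \<open>(a + b)\<^sup>2 - 4 * s\<^sup>2\<close>, which is at most
\<open>2 * (a\<^sup>2 + b\<^sup>2 - 2 * s\<^sup>2)\<close>.\<close>

lemma phase_distance_from_rank_one_difference:
  fixes a b s k :: real
  assumes "0 \<le> a" "0 \<le> b" "0 \<le> s" "a\<^sup>2 + b\<^sup>2 - 2 * s\<^sup>2 \<le> k" "0 \<le> a + b - 2 * s"
  shows "a * (a + b - 2 * s) \<le> 2 * k"
proof -
  have "a * (a + b - 2 * s) \<le> (a + b + 2 * s) * (a + b - 2 * s)"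
    using assms by (intro mult_right_mono) auto
  also have "\<dots> = (a + b)\<^sup>2 - 4 * s\<^sup>2" by (simp add: power2_eq_square algebra_simps)
  also have "\<dots> \<le> 2 * (a\<^sup>2 + b\<^sup>2) - 4 * s\<^sup>2" using sum_squares_bound[of a b] by (simp add: power2_sum)
  finally show ?thesis using assms by simp
qed

theorem theorem1:
  shows "\<exists>C>0::real. \<forall>(Q :: (real \<times> real) set) (f :: real \<Rightarrow> complex) (g :: real \<Rightarrow> complex).
    is_square 1 Q \<longrightarrow> square_integrable f \<longrightarrow> square_integrable g \<longrightarrow>
    \<not> (AE t in lebesgue. f t = 0) \<longrightarrow>
    (\<exists>\<tau>. is_arg_min (\<lambda>\<sigma>. Lp_norm 2 (lebesgue_on Q) (\<lambda>z. gabor g z - \<sigma> * gabor f z))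
            (\<lambda>\<sigma>. \<sigma> \<in> sphere 0 1) \<tau> \<and>
         Lp_norm 2 (lebesgue_on Q) (\<lambda>z. gabor g z - \<tau> * gabor f z)
           \<le> C * sqrt ((Linf_norm lebesgue (spectrogram f) + Linf_norm lebesgue (spectrogram g))
                        / Lp_norm 1 (lebesgue_on Q) (spectrogram f))
               * sqrt (Lp_norm 2 (lebesgue_on Q) (\<lambda>z. spectrogram f z - spectrogram g z)))"
proof -
  obtain C where C: "C > 0"
    "\<And>f g c z z'. square_integrable f \<Longrightarrow> square_integrable g \<Longrightarrow> z \<in> cball c 1 \<Longrightarrow> z' \<in> cball c 1 \<Longrightarrow>
       (norm (gabor f z * cnj (gabor f z') - gabor g z * cnj (gabor g z')))\<^sup>2
       \<le> C * (Linf_norm lebesgue (spectrogram f) + Linf_norm lebesgue (spectrogram g))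
           * integral (cbox c (c + (1/4, 1/4))) (\<lambda>z. \<bar>spectrogram f z - spectrogram g z\<bar>)"
    using gabor_rank_one_difference_bound by blast
  show ?thesis
    \<comment> \<open>\<open>64 = 2 * 4\<^sup>2 * 2\<close>: the comparison of the two quadratic expressions, the squared bound on the
      area of \<open>Q\<close>, and the Cauchy-Schwarz constant for \<open>\<delta>\<close>.\<close>
  proof (intro exI[of _ "8 * sqrt C"] conjI allI impI)
    show "0 < 8 * sqrt C" using C(1) by simp
    fix Q :: "(real \<times> real) set" and f g :: "real \<Rightarrow> complex"
    assume sq: "is_square 1 Q" and f: "square_integrable f" and g: "square_integrable g"
      and nz: "\<not> (AE t in lebesgue. f t = 0)"
    define M where "M = lebesgue_on Q"
    define Lf Lg where "Lf = Linf_norm lebesgue (spectrogram f)" and "Lg = Linf_norm lebesgue (spectrogram g)"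
    define \<delta> where "\<delta> = Lp_norm 2 M (\<lambda>z. spectrogram f z - spectrogram g z)"
    obtain c where Q: "compact Q" "cball c (1/2) \<subseteq> Q" "Q \<subseteq> cball c 1"
      using unit_square_geometry[OF sq] .
    have Qm: "Q \<in> sets lebesgue" using Q(1) by (auto simp: compact_imp_closed)
    have int: "integrable M h" if "continuous_on Q h" for h :: "real \<times> real \<Rightarrow> 'b::euclidean_space"
      unfolding M_def by (intro continuous_integrable_on_compact Q(1) that)
    have spM: "space M = Q" by (simp add: M_def)
    have measure_M: "measure M (space M) \<le> 4"
    proof -
      have "measure M (space M) = measure lebesgue Q"
        unfolding M_def using Qm by (simp add: measure_restrict_space)
      also have "\<dots> \<le> measure lebesgue (cbox (c - (1, 1)) (c + (1, 1)))"
      proof (rule measure_mono_fmeasurable)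
        show "Q \<subseteq> cbox (c - (1, 1)) (c + (1, 1))"
        proof
          fix z assume "z \<in> Q"
          then have "norm (z - c) \<le> 1" using Q(3) by (auto simp: dist_norm norm_minus_commute)
          moreover have "\<bar>fst w\<bar> \<le> norm w" "\<bar>snd w\<bar> \<le> norm w" for w :: "real \<times> real"
            using norm_fst_le[of "fst w" "snd w"] norm_snd_le[of "snd w" "fst w"] by simp_all
          ultimately have "\<bar>fst (z - c)\<bar> \<le> 1" "\<bar>snd (z - c)\<bar> \<le> 1"
            by (meson order_trans)+
          then show "z \<in> cbox (c - (1, 1)) (c + (1, 1))"
            by (cases z; cases c) (auto simp: cbox_Pair_eq abs_le_iff)
        qed
      qed (use Qm in auto)
      also have "\<dots> = 4" by (cases c) (simp add: content_Pair)
      finally show ?thesis .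
    qed
    have fin: "finite_measure M"
    proof (rule finite_measureI)
      have "emeasure M (space M) = emeasure lebesgue Q"
        unfolding M_def using Qm by (simp add: emeasure_restrict_space)
      then show "emeasure M (space M) \<noteq> \<infinity>"
        using fmeasurableD2[OF lmeasurable_compact[OF Q(1)]] by simp
    qed
    have contg: "continuous_on Q (gabor h)" if "square_integrable h" for h
      using that by (rule continuous_on_gabor)
    have conts: "continuous_on Q (spectrogram h)" if "square_integrable h" for h
      using that by (rule continuous_on_spectrogram)
    have iu: "integrable M (\<lambda>z. (norm (gabor f z))\<^sup>2)" and iv: "integrable M (\<lambda>z. (norm (gabor g z))\<^sup>2)"
      and iuv: "integrable M (\<lambda>z. gabor f z * cnj (gabor g z))"
      by (intro int continuous_intros contg f g)+
    define a b s where "a = (LINT z|M. (norm (gabor f z))\<^sup>2)" and "b = (LINT z|M. (norm (gabor g z))\<^sup>2)"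
      and "s = norm (LINT z|M. gabor f z * cnj (gabor g z))"
    have a_eq: "Lp_norm 1 M (spectrogram f) = a" by (simp add: Lp_norm_1 a_def spectrogram_def)
    have a_pos: "a > 0"
      using integral_spectrogram_pos[OF f nz Q(1,2)] by (simp add: a_def M_def spectrogram_def)
    have L0: "0 \<le> Lf" "0 \<le> Lg"
      using spectrogram_le_Linf_norm[OF f, of c] spectrogram_le_Linf_norm[OF g, of c]
      unfolding Lf_def Lg_def by (auto intro: order_trans[rotated] simp: spectrogram_def)
    have \<delta>0: "\<delta> \<ge> 0" by (simp add: \<delta>_def Lp_norm_2)
    have box: "integral (cbox c (c + (1/4, 1/4))) (\<lambda>z. \<bar>spectrogram f z - spectrogram g z\<bar>) \<le> 2 * \<delta>"
    proof -
      have contd: "continuous_on S (\<lambda>z. spectrogram f z - spectrogram g z)" for S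
        by (intro continuous_intros continuous_on_spectrogram f g)
      have sub: "cbox c (c + (1/4, 1/4)) \<subseteq> Q"
      proof
        fix z assume z: "z \<in> cbox c (c + (1/4, 1/4))"
        have "norm (z - c) \<le> norm (fst (z - c)) + norm (snd (z - c))"
          by (metis norm_Pair_le prod.collapse)
        also have "\<dots> \<le> 1/4 + 1/4"
          using z by (intro add_mono) (cases z; cases c; auto simp: cbox_Pair_eq)+
        finally show "z \<in> Q" using Q(2) by (auto simp: dist_norm norm_minus_commute)
      qed
      have i: "integrable (lebesgue_on Q) (\<lambda>z. \<bar>spectrogram f z - spectrogram g z\<bar>)"
        using int[of "\<lambda>z. \<bar>spectrogram f z - spectrogram g z\<bar>"] by (simp add: M_def continuous_intros contd)
      have "integral (cbox c (c + (1/4, 1/4))) (\<lambda>z. \<bar>spectrogram f z - spectrogram g z\<bar>)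
          \<le> integral Q (\<lambda>z. \<bar>spectrogram f z - spectrogram g z\<bar>)"
        by (intro integral_subset_le sub integrable_continuous continuous_intros contd
            integrable_on_lebesgue_on[OF i Qm]) auto
      also have "\<dots> = (LINT z|M. \<bar>spectrogram f z - spectrogram g z\<bar>)"
        unfolding M_def by (rule lebesgue_integral_eq_integral[OF i Qm, symmetric])
      also have "\<dots> \<le> 2 * \<delta>"
        unfolding \<delta>_def
        by (intro integral_abs_le_Lp_norm_2 fin measure_M int continuous_intros contd)
      finally show ?thesis .
    qed
    have rank_one: "(norm (gabor f z * cnj (gabor f z') - gabor g z * cnj (gabor g z')))\<^sup>2
        \<le> C * (Lf + Lg) * (2 * \<delta>)" if "z \<in> space M" "z' \<in> space M" for z z'
    proof -
      have "(norm (gabor f z * cnj (gabor f z') - gabor g z * cnj (gabor g z')))\<^sup>2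
       \<le> C * (Lf + Lg) * integral (cbox c (c + (1/4, 1/4))) (\<lambda>z. \<bar>spectrogram f z - spectrogram g z\<bar>)"
        unfolding Lf_def Lg_def using that Q(3) by (intro C(2) f g) (auto simp: spM)
      also have "\<dots> \<le> C * (Lf + Lg) * (2 * \<delta>)"
        using C(1) L0 box by (intro mult_left_mono) auto
      finally show ?thesis .
    qed
    have "a\<^sup>2 + b\<^sup>2 - 2 * s\<^sup>2 \<le> 4\<^sup>2 * (C * (Lf + Lg) * (2 * \<delta>))"
      unfolding a_def b_def s_def
      by (rule rank_one_difference_integral_bound[OF fin measure_M iu iv iuv rank_one])
         (use C(1) L0 \<delta>0 in auto)
    moreover obtain \<tau> where
      \<tau>: "is_arg_min (\<lambda>\<sigma>. Lp_norm 2 M (\<lambda>z. gabor g z - \<sigma> * gabor f z)) (\<lambda>\<sigma>. \<sigma> \<in> sphere 0 1) \<tau>"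
      and dist: "(Lp_norm 2 M (\<lambda>z. gabor g z - \<tau> * gabor f z))\<^sup>2 = a + b - 2 * s"
      using best_unimodular_multiple[OF iu iv iuv] unfolding a_def b_def s_def by blast
    moreover have "0 \<le> b" "0 \<le> s" by (auto simp: b_def s_def)
    moreover have "0 \<le> a + b - 2 * s" unfolding dist[symmetric] by simp
    ultimately have "a * (a + b - 2 * s) \<le> 2 * (4\<^sup>2 * (C * (Lf + Lg) * (2 * \<delta>)))"
      using a_pos by (intro phase_distance_from_rank_one_difference) auto
    then have "a + b - 2 * s \<le> 64 * (C * ((Lf + Lg) / a) * \<delta>)"
      using a_pos by (simp add: field_simps)
    then have "(Lp_norm 2 M (\<lambda>z. gabor g z - \<tau> * gabor f z))\<^sup>2 \<le> 64 * (C * ((Lf + Lg) / a) * \<delta>)"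
      unfolding dist .
    then have "Lp_norm 2 M (\<lambda>z. gabor g z - \<tau> * gabor f z) \<le> sqrt (64 * (C * ((Lf + Lg) / a) * \<delta>))"
      by (rule real_le_rsqrt)
    also have "\<dots> = 8 * sqrt C * sqrt ((Lf + Lg) / a) * sqrt \<delta>"
    proof -
      have "sqrt 64 = (8::real)" by (rule real_sqrt_unique) auto
      then show ?thesis by (simp only: real_sqrt_mult mult.assoc)
    qed
    finally show "\<exists>\<tau>. is_arg_min (\<lambda>\<sigma>. Lp_norm 2 (lebesgue_on Q) (\<lambda>z. gabor g z - \<sigma> * gabor f z))
            (\<lambda>\<sigma>. \<sigma> \<in> sphere 0 1) \<tau> \<and>
         Lp_norm 2 (lebesgue_on Q) (\<lambda>z. gabor g z - \<tau> * gabor f z)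
           \<le> 8 * sqrt C * sqrt ((Linf_norm lebesgue (spectrogram f) + Linf_norm lebesgue (spectrogram g))
                        / Lp_norm 1 (lebesgue_on Q) (spectrogram f))
               * sqrt (Lp_norm 2 (lebesgue_on Q) (\<lambda>z. spectrogram f z - spectrogram g z))"
      using \<tau> a_eq unfolding M_def Lf_def Lg_def \<delta>_def by blast
  qed
qed

end
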